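(* Equip $\mathbb R^n$ and $S_n$ with their Euclidean topologies, all product spaces below with the product topology, and $[0,\infty]$ with its usual extended-real topology. Define $$\mathcal L(m_0,\Sigma_0,m_1,\Sigma_1)=D_{\rm WKL}\bigl(\mathcal N(m_0,\Sigma_0)\,\big\|\,\mathcal N(m_1,\Sigma_1)\bigr)$$ on $\mathbb R^n\times S_n^+\times\mathbb R^n\times S_n^+$. Then the following statements hold. 1. $\mathcal L$ is continuous on its domain. 2. $\mathcal L$ has a unique continuous extended-real-valued (i.e. $[0,\infty]$-valued) extension $\overline{\mathcal L}$ to $$\mathcal U=\bigl(\mathbb R^n\times S_n^+\times\mathbb R^n\times\mathrm{cl}(S_n^+)\bigr)\cup\bigl(\mathbb R^n\times\mathrm{cl}(S_n^+)\times\mathbb R^n\times S_n^+\bigr).$$ If $\Sigma_0\succ0$ and $\Sigma_1\succeq0$, set $R=\Sigma_0^{-1/2}\bigl(\Sigma_0^{1/2}\Sigma_1\Sigma_0^{1/2}\bigr)^{1/2}\Sigma_0^{-1/2}$. Then $$\overline{\mathcal L}(m_0,\Sigma_0,m_1,\Sigma_1)=\frac14\mathrm{Tr}\bigl(\Sigma_0-\Sigma_1+\Sigma_0\chi(R)\bigr)+\frac14(m_1-m_0)^\top\kappa(R)(m_1-m_0).$$ If $\Sigma_0$ is singular and $\Sigma_1\succ0$, then $\overline{\mathcal L}(m_0,\Sigma_0,m_1,\Sigma_1)=+\infty$. 3. There is no continuous extension of $\overline{\mathcal L}$ to $$\mathcal X=\mathbb R^n\times\mathrm{cl}(S_n^+)\times\mathbb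 R^n\times\mathrm{cl}(S_n^+).$$ One lower-semicontinuous extension to $\mathcal X$ is $$\overline{\mathcal L}_{\rm ext}(m_0,\Sigma_0,m_1,\Sigma_1)=\begin{cases}\overline{\mathcal L}(m_0,\Sigma_0,m_1,\Sigma_1),&\Sigma_0\succ0\text{ or }\Sigma_1\succ0,\\[3pt]\frac14\lVert m_1-m_0\rVert^2,&\Sigma_0,\Sigma_1\text{ both singular}.\end{cases}$$ At a pair of Dirac measures, this chosen value equals the interior lower limit: for all $m_0,m_1\in\mathbb R^n$, $$\liminf_{\substack{\Sigma_0,\Sigma_1\succ0\\(\Sigma_0,\Sigma_1)\to(0,0)}}\mathcal L(m_0,\Sigma_0,m_1,\Sigma_1)=\frac14\lVert m_1-m_0\rVert^2.$$
   Context: $S_n$ is the space of real symmetric $n\times n$ matrices, $S_n^+$ the cone of positive definite ones and $\mathrm{cl}(S_n^+)=\{B\in S_n:B\succeq0\}$. Square roots of positive semidefinite matrices are the symmetric positive semidefinite ones and $\log$ of a positive definite matrix is the principal symmetric logarithm. The scalar profiles $\chi,\kappa:[0,\infty)\to\mathbb R$ are $$\chi(r)=\begin{cases}r^2\log(r^2),&r>0,\\0,&r=0,\end{cases}\qquad\kappa(r)=\begin{cases}\dfrac{r^2\log(r^2)-r^2+1}{(r-1)^2},&r>0,\ r\ne1,\\2,&r=1,\\1,&r=0,\end{cases}$$ and for $R\succeq0$ the matrices $\chi(R),\kappa(R)$ are obtained by applying the functions to the eigenvalues of $R$ (spectral functional calculus). Definition of $D_{\rm WKL}$. For $\mu=\mathcal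 N(m_0,\Sigma_0)$, $\nu=\mathcal N(m_1,\Sigma_1)$ with $\Sigma_0,\Sigma_1\succ0$, there is a unique quadratic function $f(x)=\frac12x^\top Ax+b^\top x$ with $A$ real symmetric and $b\in\mathbb R^n$ whose forward gradient flow $\frac{d}{dt}\varphi_t(x)=\nabla f(\varphi_t(x))=A\varphi_t(x)+b$, $\varphi_0(x)=x$, satisfies $(\varphi_1)_*\mu=\nu$ (push-forward of measures). Explicitly, $A=\log R$ with $R=\Sigma_0^{-1/2}(\Sigma_0^{1/2}\Sigma_1\Sigma_0^{1/2})^{1/2}\Sigma_0^{-1/2}$, and $b=K_1(A)^{-1}(m_1-Rm_0)$ with $K_1(A)=\int_0^1e^{sA}\,ds$. The Wasserstein KL divergence is $$D_{\rm WKL}(\mu\,\|\,\nu):=\int_{\mathbb R^n}\int_0^1\bigl(f(\varphi_1(x))-f(\varphi_t(x))\bigr)\,dt\,d\mu(x).$$ *)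

theory Defs
  imports "HOL-Analysis.Analysis"
begin

section \<open>Symmetric matrices and spectral calculus\<close>

text \<open>Matrix sets carry the subspace topology of \<open>real^'n^'n\<close>, whose norm is the
  Frobenius norm.\<close>

definition pos_def_mats :: "(real^'n^'n) set" where
  "pos_def_mats = {S. transpose S = S \<and> (\<forall>x. x \<noteq> 0 \<longrightarrow> x \<bullet> (S *v x) > 0)}"

definition pos_semidef_mats :: "(real^'n^'n) set" where
  "pos_semidef_mats = {S. transpose S = S \<and> (\<forall>x. x \<bullet> (S *v x) \<ge> 0)}"

definition mat_sqrt :: "real^'n^'n \<Rightarrow> real^'n^'n" where
  "mat_sqrt S = (THE B. B \<in> pos_semidef_mats \<and> B ** B = S)"

definition diag_mat :: "real^'n \<Rightarrow> real^'n^'n" where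
  "diag_mat d = (\<chi> i j. if i = j then d $ i else 0)"

text \<open>For symmetric \<open>S\<close> the value below does not depend on the chosen orthogonal
  diagonalisation, so the definite description denotes.\<close>

definition spectral_fun :: "(real \<Rightarrow> real) \<Rightarrow> real^'n^'n \<Rightarrow> real^'n^'n" where
  "spectral_fun h S = (THE B. \<exists>P d. orthogonal_matrix P \<and>
     S = P ** diag_mat d ** transpose P \<and>
     B = P ** diag_mat (\<chi> i. h (d $ i)) ** transpose P)"

text \<open>The profiles are only ever applied to nonnegative arguments; their values on
  negative reals are irrelevant.\<close>

definition chi_profile :: "real \<Rightarrow> real" where
  "chi_profile r = (if r = 0 then 0 else r\<^sup>2 * ln (r\<^sup>2))"

definition kappa_profile :: "real \<Rightarrow> real" where
  "kappa_profile r = (if r = 0 then 1 else if r = 1 then 2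
     else (r\<^sup>2 * ln (r\<^sup>2) - r\<^sup>2 + 1) / (r - 1)\<^sup>2)"

definition transport_mat :: "real^'n^'n \<Rightarrow> real^'n^'n \<Rightarrow> real^'n^'n" where
  "transport_mat S0 S1 =
     matrix_inv (mat_sqrt S0) ** mat_sqrt (mat_sqrt S0 ** S1 ** mat_sqrt S0)
       ** matrix_inv (mat_sqrt S0)"

section \<open>The Wasserstein KL divergence of Gaussians\<close>

definition gaussian :: "real^'n \<Rightarrow> real^'n^'n \<Rightarrow> (real^'n) measure" where
  "gaussian m S = density lborel (\<lambda>x.
     ennreal (exp (- ((x - m) \<bullet> (matrix_inv S *v (x - m))) / 2)
       / sqrt ((2 * pi) ^ CARD('n) * det S)))"

text \<open>The potentials below are quadratic, so their gradient flows are linear systems and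
  exist, uniquely, for all real times. Asking for the differential equation at every real
  \<open>t\<close> makes the flow unique as a function; only times in \<open>[0, 1]\<close> are used.\<close>

definition is_gradient_flow ::
    "(real^'n \<Rightarrow> real) \<Rightarrow> (real \<Rightarrow> real^'n \<Rightarrow> real^'n) \<Rightarrow> bool" where
  "is_gradient_flow f \<phi> \<longleftrightarrow> (\<forall>x. \<phi> 0 x = x) \<and>
     (\<forall>x t. \<exists>v. (GDERIV f (\<phi> t x) :> v) \<and>
        ((\<lambda>s. \<phi> s x) has_vector_derivative v) (at t))"

definition gradient_flow :: "(real^'n \<Rightarrow> real) \<Rightarrow> real \<Rightarrow> real^'n \<Rightarrow> real^'n" where
  "gradient_flow f = (THE \<phi>. is_gradient_flow f \<phi>)"

definition quadratic_potential :: "(real^'n \<Rightarrow> real) \<Rightarrow> bool" where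
  "quadratic_potential f \<longleftrightarrow> (\<exists>A b. transpose A = A \<and>
     f = (\<lambda>x. (x \<bullet> (A *v x)) / 2 + b \<bullet> x))"

definition wkl_potential :: "(real^'n) measure \<Rightarrow> (real^'n) measure \<Rightarrow> real^'n \<Rightarrow> real" where
  "wkl_potential \<mu> \<nu> =
     (THE f. quadratic_potential f \<and> distr \<mu> borel (gradient_flow f 1) = \<nu>)"

definition D_WKL :: "(real^'n) measure \<Rightarrow> (real^'n) measure \<Rightarrow> real" where
  "D_WKL \<mu> \<nu> = (let f = wkl_potential \<mu> \<nu>; \<phi> = gradient_flow f in
     (\<integral>x. (LBINT t:{0..1}. f (\<phi> 1 x) - f (\<phi> t x)) \<partial>\<mu>))"

section \<open>The loss and its extensions\<close>

type_synonym 'n gauss_pair =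
  "(real, 'n) vec \<times> ((real, 'n) vec, 'n) vec \<times> (real, 'n) vec \<times> ((real, 'n) vec, 'n) vec"

definition wkl_loss :: "'n::finite gauss_pair \<Rightarrow> real" where
  "wkl_loss = (\<lambda>(m0, S0, m1, S1). D_WKL (gaussian m0 S0) (gaussian m1 S1))"

definition regular_pairs :: "'n::finite gauss_pair set" where
  "regular_pairs = UNIV \<times> pos_def_mats \<times> UNIV \<times> pos_def_mats"

definition half_regular_pairs :: "'n::finite gauss_pair set" where
  "half_regular_pairs =
     (UNIV \<times> pos_def_mats \<times> UNIV \<times> pos_semidef_mats) \<union>
     (UNIV \<times> pos_semidef_mats \<times> UNIV \<times> pos_def_mats)"

definition all_pairs :: "'n::finite gauss_pair set" where
  "all_pairs = UNIV \<times> pos_semidef_mats \<times> UNIV \<times> pos_semidef_mats"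

text \<open>Continuous \<open>[0, \<infinity>]\<close>-valued extension of the loss; values of \<open>F\<close> outside
  \<open>half_regular_pairs\<close> are unconstrained.\<close>

definition is_wkl_extension :: "('n::finite gauss_pair \<Rightarrow> ereal) \<Rightarrow> bool" where
  "is_wkl_extension F \<longleftrightarrow> continuous_on half_regular_pairs F \<and>
     F ` half_regular_pairs \<subseteq> {0..\<infinity>} \<and>
     (\<forall>p\<in>regular_pairs. F p = ereal (wkl_loss p))"

text \<open>On \<open>all_pairs\<close> the second branch is exactly the case of two singular matrices, since a
  positive semidefinite matrix is singular iff it is not positive definite.\<close>

definition dirac_extension ::
    "('n::finite gauss_pair \<Rightarrow> ereal) \<Rightarrow> 'n gauss_pair \<Rightarrow> ereal" where
  "dirac_extension F = (\<lambda>(m0, S0, m1, S1).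
     if S0 \<in> pos_def_mats \<or> S1 \<in> pos_def_mats then F (m0, S0, m1, S1)
     else ereal ((norm (m1 - m0))\<^sup>2 / 4))"

definition lower_semicontinuous_on :: "'a::topological_space set \<Rightarrow> ('a \<Rightarrow> ereal) \<Rightarrow> bool" where
  "lower_semicontinuous_on X F \<longleftrightarrow>
     (\<forall>x\<in>X. \<forall>a. a < F x \<longrightarrow> (\<forall>\<^sub>F y in at x within X. a < F y))"

end

theory Submission
  imports Defs "HOL-Probability.Distributions" "HOL-Real_Asymp.Real_Asymp"
begin

text \<open>Let \<open>R\<close> be the transport matrix of two nondegenerate Gaussians, with orthonormal eigenvectors
  \<open>u\<^sub>i\<close> and eigenvalues \<open>r\<^sub>i\<close>. In this basis the potential and its flow decouple into scalar equations
  \<open>y' = a y + \<beta>\<close> with \<open>a = ln r\<^sub>i\<close>. The potential grows along the flow at the rate of the squared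
  speed, and the speed is exponential in time, so the time integral in the divergence is an explicit
  multiple of the squared initial speed. Its Gaussian expectation involves the mean and the covariance
  only. With \<open>\<psi> r = \<chi> r - r\<^sup>2 + 1\<close>, four times the loss is the sum over \<open>i\<close> of
  \<open>\<psi> r\<^sub>i (u\<^sub>i \<bullet> S\<^sub>0 u\<^sub>i) + \<kappa> r\<^sub>i (u\<^sub>i \<bullet> (m\<^sub>1 - m\<^sub>0))\<^sup>2\<close> (\<open>wkl_loss_eigen\<close>).

  The definition of the divergence selects the flow and the potential by definite descriptions, so
  both have to be shown unique: flows because scalar linear initial value problems have one solution
  (\<open>gradient_flow_quad\<close>), potentials because a Gaussian determines its mean and covariance
  (\<open>gaussian_inject\<close>) and \<open>R\<close> is the only positive semidefinite solution of \<open>R S\<^sub>0 R = S\<^sub>1\<close>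
  (\<open>transport_mat_unique\<close>).

  Since \<open>R S\<^sub>0 R = S\<^sub>1\<close>, the sum equals the trace expression of the theorem. That expression makes
  sense for singular \<open>S\<^sub>1\<close>, and it is continuous there because applying a continuous function to the
  eigenvalues is a continuous operation on matrices (\<open>continuous_on_spectral_fun\<close>).

  The behaviour at the boundary follows from two scalar inequalities. As \<open>\<psi> \<ge> 0\<close> and \<open>\<kappa> \<ge> 1\<close>, the
  loss is at least a quarter of the squared distance of the means (\<open>wkl_formula_ge\<close>), which gives
  lower semicontinuity at two singular covariances and one half of the lower limit. And \<open>\<psi> r / r\<^sup>2 \<ge> ln r\<^sup>2 - 1\<close> is unbounded
  as \<open>r \<rightarrow> \<infinity>\<close>; when \<open>S\<^sub>0\<close> degenerates while \<open>S\<^sub>1\<close> does not, some eigenvalue of \<open>R\<close> does tend to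
  infinity, and with it the loss (\<open>wkl_formula_blow_up\<close>). Finally, for \<open>S\<^sub>0 = e I\<close> and
  \<open>S\<^sub>1 = r\<^sup>2 e I\<close> the limit of the loss as \<open>e \<rightarrow> 0\<close> is \<open>\<kappa> r \<parallel>m\<^sub>1 - m\<^sub>0\<parallel>\<^sup>2 / 4\<close>
  (\<open>wkl_formula_scaled_identity\<close>). This depends on \<open>r\<close>, so no continuous extension exists, and
  \<open>r \<rightarrow> 0\<close> attains the lower limit.\<close>

section \<open>Matrices in an orthonormal eigenbasis\<close>

definition conj_diag :: "real^'n^'n \<Rightarrow> real^'n \<Rightarrow> real^'n^'n" where
  "conj_diag P d = P ** diag_mat d ** transpose P"

lemma diag_mat_mult_vector: "diag_mat d *v x = (\<chi> i. d $ i * x $ i)"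
  unfolding matrix_vector_mult_def diag_mat_def vec_eq_iff vec_lambda_beta
  by (auto simp: if_distrib[where f="\<lambda>x. x * _"] cong: if_cong)

lemma coordinate_transpose_mult: "(transpose P *v x) $ i = column i P \<bullet> (x :: real^'n)"
  by (simp add: matrix_vector_mult_def transpose_def column_def inner_vec_def del: transpose_matrix_vector)

lemma column_inner_mult_vector:
  assumes "orthogonal_matrix P"
  shows "column i P \<bullet> (P *v x) = x $ i"
proof -
  have "column i P \<bullet> (P *v x) = (transpose P *v (P *v x)) $ i"
    by (simp only: coordinate_transpose_mult)
  also have "transpose P *v (P *v x) = x"
    using assms by (simp add: matrix_vector_mul_assoc orthogonal_matrix_def del: transpose_matrix_vector)
  finally show ?thesis .
qed

text \<open>Matrix identities are checked below on the coordinates with respect to the columns of \<open>P\<close>, where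
  a diagonalised matrix acts as a multiplication.\<close>

lemma eigen_coordinate:
  assumes "orthogonal_matrix P"
  shows "column i P \<bullet> (conj_diag P d *v x) = d $ i * (column i P \<bullet> x)"
proof -
  have "conj_diag P d *v x = P *v (diag_mat d *v (transpose P *v x))"
    by (simp add: conj_diag_def matrix_vector_mul_assoc matrix_mul_assoc del: transpose_matrix_vector)
  then show ?thesis
    by (simp only: column_inner_mult_vector[OF assms] diag_mat_mult_vector vec_lambda_beta
        coordinate_transpose_mult)
qed

lemma parseval:
  fixes P :: "real^'n^'n"
  assumes "orthogonal_matrix P"
  shows "x \<bullet> y = (\<Sum>i\<in>UNIV. (column i P \<bullet> x) * (column i P \<bullet> y))"
proof -
  have "(transpose P *v x) \<bullet> (transpose P *v y) = x \<bullet> (P *v (transpose P *v y))"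
    by (simp only: transpose_matrix_vector dot_lmul_matrix)
  also have "\<dots> = x \<bullet> y"
    using assms by (simp add: matrix_vector_mul_assoc orthogonal_matrix_def del: transpose_matrix_vector)
  finally have "x \<bullet> y = (transpose P *v x) \<bullet> (transpose P *v y)" by (rule sym)
  then show ?thesis
    by (simp only: inner_vec_def coordinate_transpose_mult inner_real_def)
qed

lemma eq_by_coordinates:
  fixes P :: "real^'n^'n"
  assumes "orthogonal_matrix P" "\<And>i. column i P \<bullet> x = column i P \<bullet> y"
  shows "x = y"
proof -
  have "(x - y) \<bullet> (x - y) = 0"
    by (subst parseval[OF assms(1)]) (simp add: assms(2) inner_diff_right)
  then show ?thesis by simp
qed

lemma column_unit:
  fixes P :: "real^'n^'n"
  assumes "orthogonal_matrix P"
  shows "column i P \<bullet> column i P = 1"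
  using assms by (metis norm_eq_1 orthogonal_matrix_orthonormal_columns)

lemma eigenvector_column:
  assumes "orthogonal_matrix P"
  shows "conj_diag P d *v column i P = d $ i *\<^sub>R column i P"
proof (rule eq_by_coordinates[OF assms])
  fix j
  show "column j P \<bullet> (conj_diag P d *v column i P) = column j P \<bullet> (d $ i *\<^sub>R column i P)"
    using assms unfolding eigen_coordinate[OF assms]
    by (cases "i = j") (auto simp: orthogonal_matrix_orthonormal_columns orthogonal_def)
qed

lemma transpose_conj_diag: "transpose (conj_diag P d) = conj_diag P d"
proof -
  have "transpose (diag_mat d) = diag_mat d"
    by (auto simp: transpose_def diag_mat_def vec_eq_iff)
  then show ?thesis by (simp add: conj_diag_def matrix_transpose_mul matrix_mul_assoc)
qed

lemma conj_diag_mult: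
  assumes "orthogonal_matrix P"
  shows "conj_diag P d ** conj_diag P e = conj_diag P (\<chi> i. d $ i * e $ i)"
  unfolding matrix_eq
proof
  fix x
  show "conj_diag P d ** conj_diag P e *v x = conj_diag P (\<chi> i. d $ i * e $ i) *v x"
    by (rule eq_by_coordinates[OF assms])
      (simp add: matrix_vector_mul_assoc[symmetric] eigen_coordinate[OF assms])
qed

lemma conj_diag_one:
  assumes "orthogonal_matrix P"
  shows "conj_diag P (\<chi> i. 1) = mat 1"
  unfolding matrix_eq
  by (intro allI eq_by_coordinates[OF assms]) (simp add: eigen_coordinate[OF assms])

lemma inner_conj_diag:
  assumes "orthogonal_matrix P"
  shows "x \<bullet> (conj_diag P d *v y) = (\<Sum>i\<in>UNIV. d $ i * (column i P \<bullet> x) * (column i P \<bullet> y))"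
  by (subst parseval[OF assms]) (simp add: eigen_coordinate[OF assms] mult_ac)

lemma symmetric_inner:
  assumes "transpose S = S"
  shows "(S *v x) \<bullet> y = x \<bullet> (S *v (y :: real^'n))"
  unfolding dot_lmul_matrix[symmetric] by (simp only: transpose_matrix_vector[symmetric] assms)

text \<open>The trace is invariant under conjugation by \<open>P\<close>.\<close>

lemma trace_eq_sum_quadratic:
  assumes "orthogonal_matrix P"
  shows "trace M = (\<Sum>i\<in>UNIV. column i P \<bullet> (M *v column i P))"
proof -
  have "trace M = trace (transpose P ** (M ** P))"
    using assms by (simp add: trace_mul_sym[of "transpose P"] matrix_mul_assoc[symmetric]
        orthogonal_matrix_def)
  also have "\<dots> = (\<Sum>i\<in>UNIV. column i P \<bullet> (M *v column i P))"
    unfolding trace_def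
  proof (rule sum.cong[OF refl])
    fix i
    have "(transpose P ** (M ** P)) $ i $ i = (\<Sum>k\<in>UNIV. P $ k $ i * (M ** P) $ k $ i)"
      by (simp add: matrix_matrix_mult_def transpose_def)
    also have "\<dots> = column i P \<bullet> (M *v column i P)"
      by (simp add: inner_vec_def column_def matrix_matrix_mult_def matrix_vector_mult_def)
    finally show "(transpose P ** (M ** P)) $ i $ i = column i P \<bullet> (M *v column i P)" .
  qed
  finally show ?thesis .
qed

lemma trace_mult_conj_diag:
  assumes "orthogonal_matrix P"
  shows "trace (S ** conj_diag P d) = (\<Sum>i\<in>UNIV. d $ i * (column i P \<bullet> (S *v column i P)))"
  unfolding trace_eq_sum_quadratic[OF assms]
  by (simp add: matrix_vector_mul_assoc[symmetric] eigenvector_column[OF assms]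
      matrix_vector_mult_scaleR)

lemma det_conj_diag:
  assumes "orthogonal_matrix P"
  shows "det (conj_diag P d) = (\<Prod>i\<in>UNIV. d $ i)"
proof -
  have "det (diag_mat d) = (\<Prod>i\<in>UNIV. d $ i)"
    by (subst det_diagonal) (auto simp: diag_mat_def)
  moreover have "det P * det P = 1"
    using det_orthogonal_matrix[OF assms] by auto
  ultimately show ?thesis
    by (simp add: conj_diag_def det_mul det_transpose)
qed

lemma matrix_inv_unique:
  fixes A B :: "real^'n^'n"
  assumes "A ** B = mat 1"
  shows "matrix_inv A = B"
proof -
  have BA: "B ** A = mat 1" using assms matrix_left_right_inverse by blast
  have "\<exists>X. A ** X = mat 1 \<and> X ** A = mat 1" using assms BA by blast
  then have *: "A ** matrix_inv A = mat 1 \<and> matrix_inv A ** A = mat 1"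
    unfolding matrix_inv_def by (rule someI_ex)
  have "matrix_inv A = (B ** A) ** matrix_inv A" by (simp add: BA)
  also have "\<dots> = B" using * by (simp add: matrix_mul_assoc[symmetric])
  finally show ?thesis .
qed

lemma matrix_inv_conj_diag:
  assumes "orthogonal_matrix P" "\<And>i. d $ i \<noteq> 0"
  shows "matrix_inv (conj_diag P d) = conj_diag P (\<chi> i. inverse (d $ i))"
  by (rule matrix_inv_unique) (simp add: conj_diag_mult[OF assms(1)] assms(2) conj_diag_one[OF assms(1)])

lemma conj_diag_pos_semidef_iff:
  assumes "orthogonal_matrix P"
  shows "conj_diag P d \<in> pos_semidef_mats \<longleftrightarrow> (\<forall>i. 0 \<le> d $ i)"
proof
  assume "conj_diag P d \<in> pos_semidef_mats"
  then have "column i P \<bullet> (conj_diag P d *v column i P) \<ge> 0" for i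
    by (simp add: pos_semidef_mats_def)
  then show "\<forall>i. 0 \<le> d $ i"
    by (simp add: eigenvector_column[OF assms] column_unit[OF assms])
next
  assume "\<forall>i. 0 \<le> d $ i"
  then show "conj_diag P d \<in> pos_semidef_mats"
    by (auto simp: pos_semidef_mats_def transpose_conj_diag inner_conj_diag[OF assms] mult.assoc
        intro!: sum_nonneg)
qed

lemma conj_diag_pos_def_iff:
  assumes "orthogonal_matrix P"
  shows "conj_diag P d \<in> pos_def_mats \<longleftrightarrow> (\<forall>i. 0 < d $ i)"
proof
  assume *: "conj_diag P d \<in> pos_def_mats"
  have "column i P \<noteq> 0" for i using column_unit[OF assms, of i] by auto
  with * have "column i P \<bullet> (conj_diag P d *v column i P) > 0" for i
    by (simp add: pos_def_mats_def)
  then show "\<forall>i. 0 < d $ i"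
    by (simp add: eigenvector_column[OF assms] column_unit[OF assms])
next
  assume d: "\<forall>i. 0 < d $ i"
  have "x \<bullet> (conj_diag P d *v x) > 0" if "x \<noteq> 0" for x
  proof -
    have "\<exists>i. column i P \<bullet> x \<noteq> 0"
      using eq_by_coordinates[OF assms, of x 0] that by auto
    then obtain i where "column i P \<bullet> x \<noteq> 0" ..
    then have "0 < d $ i * (column i P \<bullet> x) * (column i P \<bullet> x)"
      using d by (simp add: mult.assoc zero_less_mult_iff) (meson linorder_neqE_linordered_idom)
    then show ?thesis unfolding inner_conj_diag[OF assms]
      using d by (intro sum_pos2[where i=i]) (auto simp: mult.assoc less_imp_le)
  qed
  then show "conj_diag P d \<in> pos_def_mats"
    by (simp add: pos_def_mats_def transpose_conj_diag)
qed

lemma pos_def_imp_semidef: "S \<in> pos_def_mats \<Longrightarrow> S \<in> pos_semidef_mats"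
  unfolding pos_def_mats_def pos_semidef_mats_def
  by (auto, metis inner_zero_left less_eq_real_def)

section \<open>The spectral theorem\<close>

text \<open>The eigenvector is a maximiser of the quadratic form on the unit sphere of \<open>V\<close>, which exists by
  compactness.\<close>

lemma eigenvector_in_invariant_subspace:
  fixes S :: "real^'n^'n"
  assumes sym: "transpose S = S" and V: "subspace V" "\<And>x. x \<in> V \<Longrightarrow> S *v x \<in> V" and "V \<noteq> {0}"
  obtains v l where "v \<in> V" "norm v = 1" "S *v v = l *\<^sub>R v"
proof -
  have "compact (sphere 0 1 \<inter> V)"
    by (intro compact_Int_closed compact_sphere closed_subspace V)
  moreover obtain w where w: "w \<in> V" "w \<noteq> 0" using assms(4) subspace_0[OF V(1)] by auto
  have "w /\<^sub>R norm w \<in> sphere 0 1 \<inter> V"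
    using w V(1) by (simp add: subspace_scale)
  then have "sphere 0 1 \<inter> V \<noteq> {}" by blast
  moreover have "continuous_on (sphere 0 1 \<inter> V) (\<lambda>x. x \<bullet> (S *v x))"
    by (intro continuous_intros linear_continuous_on linear_conv_bounded_linear[THEN iffD1]) auto
  ultimately have "\<exists>v\<in>sphere 0 1 \<inter> V. \<forall>x\<in>sphere 0 1 \<inter> V. x \<bullet> (S *v x) \<le> v \<bullet> (S *v v)"
    by (rule continuous_attains_sup)
  then obtain v where v: "v \<in> V" "norm v = 1"
    and max: "\<And>x. x \<in> V \<Longrightarrow> norm x = 1 \<Longrightarrow> x \<bullet> (S *v x) \<le> v \<bullet> (S *v v)"
    by auto
  define l where "l = v \<bullet> (S *v v)"
  have le: "x \<bullet> (S *v x) \<le> l * (x \<bullet> x)" if "x \<in> V" for x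
  proof (cases "x = 0")
    case False
    have "(x /\<^sub>R norm x) \<bullet> (S *v (x /\<^sub>R norm x)) \<le> l"
      unfolding l_def using that False V(1) by (intro max) (auto simp: subspace_scale)
    then have "x \<bullet> (S *v x) / (norm x * norm x) \<le> l"
      by (simp add: matrix_vector_mult_scaleR divide_inverse mult_ac)
    then show ?thesis using False
      by (simp add: divide_le_eq zero_less_mult_iff dot_square_norm power2_eq_square split: if_splits)
  qed simp
  define w where "w = S *v v - l *\<^sub>R v"
  have "w \<in> V" unfolding w_def using v V by (simp add: subspace_diff subspace_scale)
  have vw: "v \<bullet> w = 0" unfolding w_def using v
    by (simp add: inner_diff_right l_def dot_square_norm)
  have wSv: "w \<bullet> (S *v v) = w \<bullet> w"
    using vw by (simp add: w_def inner_diff_right inner_commute)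
  \<comment> \<open>First-order optimality of \<open>v\<close> in the direction of its own residual \<open>w\<close> forces \<open>w = 0\<close>.\<close>
  have opt: "2 * t * (w \<bullet> w) \<le> t\<^sup>2 * (l * (w \<bullet> w) - w \<bullet> (S *v w))" for t
  proof -
    have "(v + t *\<^sub>R w) \<bullet> (S *v (v + t *\<^sub>R w)) \<le> l * ((v + t *\<^sub>R w) \<bullet> (v + t *\<^sub>R w))"
      using \<open>w \<in> V\<close> v V(1) by (intro le) (simp add: subspace_add subspace_scale)
    moreover have "(v + t *\<^sub>R w) \<bullet> (S *v (v + t *\<^sub>R w)) = l + 2 * t * (w \<bullet> w) + t\<^sup>2 * (w \<bullet> (S *v w))"
      using wSv symmetric_inner[OF sym, of v w]
      by (simp add: matrix_vector_right_distrib matrix_vector_mult_scaleR inner_add_left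
          inner_add_right l_def power2_eq_square inner_commute algebra_simps)
    moreover have "(v + t *\<^sub>R w) \<bullet> (v + t *\<^sub>R w) = 1 + t\<^sup>2 * (w \<bullet> w)"
      using vw v by (simp add: inner_add_left inner_add_right inner_commute norm_eq_1 power2_eq_square)
    ultimately have "l + 2 * t * (w \<bullet> w) + t\<^sup>2 * (w \<bullet> (S *v w)) \<le> l * (1 + t\<^sup>2 * (w \<bullet> w))"
      by (simp only:)
    then show ?thesis by (simp add: algebra_simps)
  qed
  have "w \<bullet> w \<le> 0"
  proof -
    define K where "K = l * (w \<bullet> w) - w \<bullet> (S *v w)"
    have "\<forall>\<^sub>F t in at_right 0. 2 * (w \<bullet> w) \<le> t * K"
      unfolding eventually_at_filter
    proof (intro always_eventually allI impI)
      fix t :: real assume "t \<noteq> 0" "t \<in> {0<..}"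
      then show "2 * (w \<bullet> w) \<le> t * K"
        using opt[of t] by (simp add: K_def power2_eq_square mult.assoc mult.left_commute)
    qed
    moreover have "((\<lambda>t. t * K) \<longlongrightarrow> 0 * K) (at_right 0)"
      by (intro tendsto_intros)
    ultimately have "2 * (w \<bullet> w) \<le> 0"
      using tendsto_lowerbound[of "\<lambda>t. t * K" 0 "at_right 0"] by simp
    then show ?thesis by simp
  qed
  then have "w = 0" by (metis inner_ge_zero inner_eq_zero_iff order_antisym)
  then show ?thesis using that[of v l] v by (simp add: w_def)
qed

text \<open>Take a set of orthonormal eigenvectors of maximal size. Its orthogonal complement is invariant
  under \<open>S\<close>, so if it were nontrivial it would contribute one more eigenvector.\<close>

lemma spectral_theorem:
  fixes S :: "real^'n^'n"
  assumes sym: "transpose S = S"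
  obtains P d where "orthogonal_matrix P" "S = conj_diag P d"
proof -
  define good where "good B \<longleftrightarrow> pairwise orthogonal B \<and>
    (\<forall>b\<in>B. norm b = 1 \<and> (\<exists>l. S *v b = l *\<^sub>R b))" for B
  have indep: "independent B" if "good B" for B
    using that unfolding good_def by (intro pairwise_orthogonal_independent) auto
  have bound: "card B \<le> CARD('n)" "finite B" if "good B" for B
    using independent_bound[OF indep[OF that]] by auto
  have "good {}" by (simp add: good_def)
  moreover have "\<forall>B. good B \<longrightarrow> card B < Suc (CARD('n))"
    using bound(1) by (simp add: less_Suc_eq_le)
  ultimately have "\<exists>B. good B \<and> (\<forall>C. good C \<longrightarrow> card C \<le> card B)"
    by (rule ex_has_greatest_nat)
  then obtain B where B: "good B" and maxB: "\<And>C. good C \<Longrightarrow> card C \<le> card B"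
    by (elim exE conjE) simp
  define V where "V = {x. \<forall>b\<in>B. b \<bullet> x = 0}"
  have "subspace V"
    by (auto simp: V_def subspace_def inner_add_right)
  moreover have "S *v x \<in> V" if "x \<in> V" for x
  proof -
    have "b \<bullet> (S *v x) = 0" if "b \<in> B" for b
    proof -
      obtain l where "S *v b = l *\<^sub>R b" using B \<open>b \<in> B\<close> by (auto simp: good_def)
      then show ?thesis using symmetric_inner[OF sym, of b x] \<open>x \<in> V\<close> \<open>b \<in> B\<close>
        by (simp add: V_def)
    qed
    then show ?thesis by (simp add: V_def)
  qed
  ultimately have "V = {0}"
  proof (rule_tac ccontr)
    assume V: "subspace V" "\<And>x. x \<in> V \<Longrightarrow> S *v x \<in> V" "V \<noteq> {0}"
    then obtain v l where v: "v \<in> V" "norm v = 1" "S *v v = l *\<^sub>R v"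
      using eigenvector_in_invariant_subspace[OF sym] by blast
    then have "v \<notin> B" by (auto simp: V_def)
    have "good (insert v B)"
      using B v by (auto simp: good_def V_def pairwise_insert orthogonal_def inner_commute)
    then have "card (insert v B) \<le> card B" by (rule maxB)
    then show False using \<open>v \<notin> B\<close> bound[OF B] by simp
  qed
  have "span B = UNIV"
  proof -
    have "x \<in> span B" for x
    proof -
      obtain y z where "y \<in> span B" "\<And>w. w \<in> span B \<Longrightarrow> orthogonal z w" "x = y + z"
        using orthogonal_subspace_decomp_exists[of B x] by metis
      moreover from this have "z \<in> V"
        by (auto simp: V_def orthogonal_def inner_commute span_base)
      ultimately show ?thesis using \<open>V = {0}\<close> by auto
    qed
    then show ?thesis by auto
  qed
  then have "card B = CARD('n)"
    using dim_eq_card[of B "UNIV :: (real^'n) set"] indep[OF B] by simp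
  then obtain f :: "'n \<Rightarrow> real^'n" where f: "bij_betw f UNIV B"
    using bound[OF B] finite_same_card_bij[of "UNIV :: 'n set" B] by auto
  have fB: "f i \<in> B" for i using f by (auto simp: bij_betw_def)
  have inj: "i \<noteq> j \<Longrightarrow> f i \<noteq> f j" for i j using f by (auto simp: bij_betw_def inj_def)
  define P :: "real^'n^'n" where "P = (\<chi> i j. f j $ i)"
  have col: "column i P = f i" for i by (simp add: P_def column_def)
  have P: "orthogonal_matrix P"
    unfolding orthogonal_matrix_orthonormal_columns col
  proof (intro conjI allI impI)
    show "norm (f i) = 1" for i using B fB[of i] by (simp add: good_def)
    show "orthogonal (f i) (f j)" if "i \<noteq> j" for i j
      using B pairwiseD[of orthogonal B, OF _ fB fB inj[OF that]] by (simp add: good_def)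
  qed
  have "\<forall>i. \<exists>l. S *v f i = l *\<^sub>R f i"
    using B fB unfolding good_def by blast
  then have "\<exists>l. \<forall>i. S *v f i = l i *\<^sub>R f i" by (rule choice)
  then obtain l where l: "\<And>i. S *v f i = l i *\<^sub>R f i" by blast
  have "S = conj_diag P (\<chi> i. l i)"
    unfolding matrix_eq
  proof (intro allI eq_by_coordinates[OF P])
    fix x i
    show "column i P \<bullet> (S *v x) = column i P \<bullet> (conj_diag P (\<chi> i. l i) *v x)"
      using symmetric_inner[OF sym, of "f i" x] l eigen_coordinate[OF P, of i "\<chi> i. l i" x]
      by (simp add: col)
  qed
  then show ?thesis using that P by blast
qed

lemma spectral_theorem_pos_semidef:
  assumes "S \<in> pos_semidef_mats"
  obtains P d where "orthogonal_matrix P" "S = conj_diag P d" "\<And>i. 0 \<le> d $ i"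
proof -
  have "transpose S = S" using assms by (simp add: pos_semidef_mats_def)
  then obtain P d where "orthogonal_matrix P" "S = conj_diag P d" by (rule spectral_theorem)
  with assms show ?thesis using that by (simp add: conj_diag_pos_semidef_iff)
qed

lemma spectral_theorem_pos_def:
  assumes "S \<in> pos_def_mats"
  obtains P d where "orthogonal_matrix P" "S = conj_diag P d" "\<And>i. 0 < d $ i"
proof -
  have "transpose S = S" using assms by (simp add: pos_def_mats_def)
  then obtain P d where "orthogonal_matrix P" "S = conj_diag P d" by (rule spectral_theorem)
  with assms show ?thesis using that by (simp add: conj_diag_pos_def_iff)
qed

section \<open>Spectral calculus\<close>

text \<open>Independence of the diagonalisation, which makes the definite description in \<open>spectral_fun\<close>
  denote.\<close>

lemma conj_diag_apply_cong:
  assumes P: "orthogonal_matrix P" and Q: "orthogonal_matrix Q"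
    and eq: "conj_diag P d = conj_diag Q e"
  shows "conj_diag P (\<chi> i. h (d $ i)) = conj_diag Q (\<chi> i. h (e $ i))"
  unfolding matrix_eq
proof (intro allI eq_by_coordinates[OF P])
  fix x i
  \<comment> \<open>Eigenvectors of distinct eigenvalues are orthogonal, so the overlap of the two bases only
    couples equal eigenvalues.\<close>
  have couple: "h (d $ i) * (column j Q \<bullet> column i P) = h (e $ j) * (column j Q \<bullet> column i P)" for j
  proof (cases "d $ i = e $ j")
    case False
    have "d $ i * (column j Q \<bullet> column i P) = column j Q \<bullet> (conj_diag P d *v column i P)"
      by (simp add: eigenvector_column[OF P])
    also have "\<dots> = e $ j * (column j Q \<bullet> column i P)"
      by (simp add: eq eigen_coordinate[OF Q])
    finally show ?thesis using False by simp
  qed simp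
  have "column i P \<bullet> (conj_diag P (\<chi> i. h (d $ i)) *v x) = h (d $ i) * (column i P \<bullet> x)"
    by (simp add: eigen_coordinate[OF P])
  also have "\<dots> = (\<Sum>j\<in>UNIV. (h (d $ i) * (column j Q \<bullet> column i P)) * (column j Q \<bullet> x))"
    by (simp add: parseval[OF Q, of "column i P" x] sum_distrib_left mult.assoc)
  also have "\<dots> = column i P \<bullet> (conj_diag Q (\<chi> i. h (e $ i)) *v x)"
    unfolding couple inner_conj_diag[OF Q] by (simp add: mult.assoc)
  finally show "column i P \<bullet> (conj_diag P (\<chi> i. h (d $ i)) *v x) =
    column i P \<bullet> (conj_diag Q (\<chi> i. h (e $ i)) *v x)" .
qed

lemma spectral_fun_conj_diag:
  assumes P: "orthogonal_matrix P"
  shows "spectral_fun h (conj_diag P d) = conj_diag P (\<chi> i. h (d $ i))"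
  unfolding spectral_fun_def
proof (rule the_equality)
  show "\<exists>Pa da. orthogonal_matrix Pa \<and> conj_diag P d = Pa ** diag_mat da ** transpose Pa \<and>
    conj_diag P (\<chi> i. h (d $ i)) = Pa ** diag_mat (\<chi> i. h (da $ i)) ** transpose Pa"
    using P unfolding conj_diag_def by blast
next
  fix B assume "\<exists>Pa da. orthogonal_matrix Pa \<and> conj_diag P d = Pa ** diag_mat da ** transpose Pa \<and>
    B = Pa ** diag_mat (\<chi> i. h (da $ i)) ** transpose Pa"
  then obtain Q e where Q: "orthogonal_matrix Q" and eq: "conj_diag P d = conj_diag Q e"
    and B: "B = conj_diag Q (\<chi> i. h (e $ i))"
    unfolding conj_diag_def[symmetric] by blast
  show "B = conj_diag P (\<chi> i. h (d $ i))"
    unfolding B by (rule conj_diag_apply_cong[OF P Q eq, symmetric])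
qed

text \<open>Squaring a diagonalised root gives a diagonalisation of \<open>S\<close>; for nonnegative eigenvalues the
  spectral square root undoes this, so every positive semidefinite root is \<open>spectral_fun sqrt S\<close>.\<close>

lemma mat_sqrt_pos_semidef:
  assumes "S \<in> pos_semidef_mats"
  shows "mat_sqrt S = spectral_fun sqrt S" "mat_sqrt S \<in> pos_semidef_mats"
    "mat_sqrt S ** mat_sqrt S = S"
proof -
  obtain P d where P: "orthogonal_matrix P" and S: "S = conj_diag P d" and d: "\<And>i. 0 \<le> d $ i"
    using assms by (rule spectral_theorem_pos_semidef) blast
  let ?B = "conj_diag P (\<chi> i. sqrt (d $ i))"
  have f: "spectral_fun sqrt S = ?B" unfolding S by (rule spectral_fun_conj_diag[OF P])
  have B: "?B \<in> pos_semidef_mats" "?B ** ?B = S"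
    by (simp_all add: conj_diag_pos_semidef_iff[OF P] conj_diag_mult[OF P] d S)
  have "mat_sqrt S = ?B"
    unfolding mat_sqrt_def
  proof (rule the_equality)
    fix C assume C: "C \<in> pos_semidef_mats \<and> C ** C = S"
    then obtain Q e where Q: "orthogonal_matrix Q" and e: "C = conj_diag Q e" "\<And>i. 0 \<le> e $ i"
      using spectral_theorem_pos_semidef by blast
    have "S = conj_diag Q (\<chi> i. e $ i * e $ i)" using C e by (simp add: conj_diag_mult[OF Q])
    then have "spectral_fun sqrt S = C"
      using spectral_fun_conj_diag[OF Q, of sqrt "\<chi> i. e $ i * e $ i"] e by simp
    then show "C = ?B" using f by simp
  qed (use B in simp)
  then show "mat_sqrt S = spectral_fun sqrt S" "mat_sqrt S \<in> pos_semidef_mats"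
    "mat_sqrt S ** mat_sqrt S = S" using f B by auto
qed

lemma mat_sqrt_unique:
  assumes "B \<in> pos_semidef_mats" "B ** B = S"
  shows "mat_sqrt S = B"
proof -
  obtain Q e where Q: "orthogonal_matrix Q" and e: "B = conj_diag Q e" "\<And>i. 0 \<le> e $ i"
    using assms(1) by (rule spectral_theorem_pos_semidef) blast
  have S: "S = conj_diag Q (\<chi> i. e $ i * e $ i)" using assms(2) e by (simp add: conj_diag_mult[OF Q])
  have "S \<in> pos_semidef_mats" unfolding S conj_diag_pos_semidef_iff[OF Q] by simp
  then have "mat_sqrt S = spectral_fun sqrt S" by (rule mat_sqrt_pos_semidef)
  also have "\<dots> = B" unfolding S spectral_fun_conj_diag[OF Q] using e by simp
  finally show ?thesis .
qed

section \<open>Continuity of the spectral calculus\<close>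

lemma conj_diag_inject:
  assumes "orthogonal_matrix P" "conj_diag P d = conj_diag P e"
  shows "d = e"
proof -
  have "d $ i = e $ i" for i
    using assms(2) eigen_coordinate[OF assms(1), of i d "column i P"]
      eigen_coordinate[OF assms(1), of i e "column i P"] column_unit[OF assms(1), of i] by simp
  then show ?thesis by (simp add: vec_eq_iff)
qed

lemma tendsto_matrix_mult [tendsto_intros]:
  fixes f :: "'a \<Rightarrow> real^'n^'m" and g :: "'a \<Rightarrow> real^'k^'n"
  assumes "(f \<longlongrightarrow> A) F" "(g \<longlongrightarrow> B) F"
  shows "((\<lambda>x. f x ** g x) \<longlongrightarrow> A ** B) F"
  unfolding matrix_matrix_mult_def
  by (intro vec_tendstoI) (simp, intro tendsto_intros tendsto_vec_nth assms)

lemma tendsto_matrix_vector_mult [tendsto_intros]: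
  fixes f :: "'a \<Rightarrow> real^'n^'m"
  assumes "(f \<longlongrightarrow> A) F" "(g \<longlongrightarrow> x) F"
  shows "((\<lambda>t. f t *v g t) \<longlongrightarrow> A *v x) F"
  unfolding matrix_vector_mult_def
  by (intro vec_tendstoI) (simp, intro tendsto_intros tendsto_vec_nth assms)

lemma tendsto_transpose [tendsto_intros]:
  fixes f :: "'a \<Rightarrow> real^'n^'m"
  assumes "(f \<longlongrightarrow> A) F"
  shows "((\<lambda>t. transpose (f t)) \<longlongrightarrow> transpose A) F"
  unfolding transpose_def
  by (intro vec_tendstoI) (simp, intro tendsto_intros tendsto_vec_nth assms)

lemma tendsto_column [tendsto_intros]:
  fixes f :: "'a \<Rightarrow> real^'n^'m"
  assumes "(f \<longlongrightarrow> A) F"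
  shows "((\<lambda>t. column i (f t)) \<longlongrightarrow> column i A) F"
  unfolding column_def
  by (intro vec_tendstoI) (simp, intro tendsto_intros tendsto_vec_nth assms)

lemma tendsto_diag_mat [tendsto_intros]:
  assumes "\<And>i. ((\<lambda>t. f t $ i) \<longlongrightarrow> d $ i) F"
  shows "((\<lambda>t. diag_mat (f t)) \<longlongrightarrow> diag_mat d) F"
  unfolding diag_mat_def
  by (intro vec_tendstoI) (auto intro!: assms tendsto_const)

lemma tendsto_trace [tendsto_intros]:
  fixes f :: "'a \<Rightarrow> real^'n^'n"
  assumes "(f \<longlongrightarrow> A) F"
  shows "((\<lambda>t. trace (f t)) \<longlongrightarrow> trace A) F"
  unfolding trace_def by (intro tendsto_intros tendsto_vec_nth assms)

lemma tendsto_conj_diag [tendsto_intros]: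
  assumes "(f \<longlongrightarrow> P) F" "\<And>i. ((\<lambda>t. g t $ i) \<longlongrightarrow> d $ i) F"
  shows "((\<lambda>t. conj_diag (f t) (g t)) \<longlongrightarrow> conj_diag P d) F"
  unfolding conj_diag_def by (intro tendsto_intros assms)

lemma continuous_on_matrix_mult [continuous_intros]:
  fixes f :: "'a::topological_space \<Rightarrow> real^'n^'m" and g :: "'a \<Rightarrow> real^'k^'n"
  assumes "continuous_on X f" "continuous_on X g"
  shows "continuous_on X (\<lambda>x. f x ** g x)"
  using assms by (auto simp: continuous_on_def intro!: tendsto_intros)

lemma continuous_on_matrix_vector_mult [continuous_intros]:
  fixes f :: "'a::topological_space \<Rightarrow> real^'n^'m"
  assumes "continuous_on X f" "continuous_on X g"
  shows "continuous_on X (\<lambda>x. f x *v g x)"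
  using assms by (auto simp: continuous_on_def intro!: tendsto_intros)

lemma continuous_on_trace [continuous_intros]:
  fixes f :: "'a::topological_space \<Rightarrow> real^'n^'n"
  assumes "continuous_on X f"
  shows "continuous_on X (\<lambda>x. trace (f x))"
  using assms by (auto simp: continuous_on_def intro!: tendsto_intros)

lemma norm_orthogonal_matrix_le:
  fixes P :: "real^'n^'n"
  assumes "orthogonal_matrix P"
  shows "norm P \<le> CARD('n)"
proof -
  have "norm (P $ i) = 1" for i
    using assms unfolding orthogonal_matrix_orthonormal_rows row_def
    by (metis (no_types) vec_lambda_eta)
  moreover have "norm P \<le> (\<Sum>i\<in>UNIV. norm (P $ i))"
    unfolding norm_vec_def by (rule L2_set_le_sum) simp
  ultimately show ?thesis by simp
qed

definition mats_with_spectrum :: "real set \<Rightarrow> (real^'n^'n) set" where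
  "mats_with_spectrum U = {conj_diag P d | P d. orthogonal_matrix P \<and> (\<forall>i. d $ i \<in> U)}"

text \<open>The indicator of \<open>U\<close>, applied to the matrix, gives the identity for one diagonalisation and hence
  for every other one.\<close>

lemma mats_with_spectrum_iff:
  assumes P: "orthogonal_matrix P"
  shows "conj_diag P d \<in> mats_with_spectrum U \<longleftrightarrow> (\<forall>i. d $ i \<in> U)"
proof
  assume "conj_diag P d \<in> mats_with_spectrum U"
  then obtain Q e where Q: "orthogonal_matrix Q" and eq: "conj_diag P d = conj_diag Q e"
    and e: "\<And>i. e $ i \<in> U"
    by (auto simp: mats_with_spectrum_def)
  have "conj_diag P (\<chi> i. indicator U (d $ i)) = conj_diag Q (\<chi> i. indicator U (e $ i))"
    by (rule conj_diag_apply_cong[OF P Q eq])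
  also have "\<dots> = conj_diag P (\<chi> i. 1)"
    using e by (simp add: conj_diag_one[OF P] conj_diag_one[OF Q])
  finally have "(\<chi> i. indicator U (d $ i)) = (\<chi> i. (1 :: real))"
    by (rule conj_diag_inject[OF P])
  then show "\<forall>i. d $ i \<in> U" by (simp add: vec_eq_iff indicator_def split: if_splits)
qed (use P in \<open>auto simp: mats_with_spectrum_def\<close>)

lemma pos_def_mats_spectrum: "pos_def_mats = mats_with_spectrum {0<..}"
proof (intro set_eqI iffI)
  fix S :: "real^'n^'n" assume "S \<in> pos_def_mats"
  then obtain P d where "orthogonal_matrix P" "S = conj_diag P d" "\<And>i. 0 < d $ i"
    by (rule spectral_theorem_pos_def) blast
  then show "S \<in> mats_with_spectrum {0<..}" by (simp add: mats_with_spectrum_iff)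
qed (auto simp: mats_with_spectrum_def conj_diag_pos_def_iff)

lemma pos_semidef_mats_spectrum: "pos_semidef_mats = mats_with_spectrum {0..}"
proof (intro set_eqI iffI)
  fix S :: "real^'n^'n" assume "S \<in> pos_semidef_mats"
  then obtain P d where "orthogonal_matrix P" "S = conj_diag P d" "\<And>i. 0 \<le> d $ i"
    by (rule spectral_theorem_pos_semidef) blast
  then show "S \<in> mats_with_spectrum {0..}" by (simp add: mats_with_spectrum_iff)
qed (auto simp: mats_with_spectrum_def conj_diag_pos_semidef_iff)

text \<open>Orthogonal matrices form a compact set, so along a subsequence the eigenbases of a convergent
  sequence of matrices converge. The eigenvalues are quadratic forms of the basis vectors and converge
  with them, and the limits diagonalise the limit matrix. Hence every subsequence of the images has a
  further subsequence with the right limit.\<close>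

lemma continuous_on_spectral_fun:
  assumes h: "continuous_on U h"
  shows "continuous_on (mats_with_spectrum U :: (real^'n^'n) set) (spectral_fun h)"
  unfolding continuous_on_sequentially
proof (intro ballI allI impI, elim conjE)
  fix x :: "nat \<Rightarrow> real^'n^'n" and A
  assume A: "A \<in> mats_with_spectrum U" and x: "\<forall>n. x n \<in> mats_with_spectrum U" and lim: "x \<longlonglongrightarrow> A"
  show "(spectral_fun h \<circ> x) \<longlonglongrightarrow> spectral_fun h A"
  proof (rule ccontr)
    assume "\<not> ?thesis"
    then obtain \<epsilon> where \<epsilon>: "\<epsilon> > 0"
      and "\<not> (\<forall>\<^sub>F n in sequentially. dist (spectral_fun h (x n)) (spectral_fun h A) < \<epsilon>)"
      unfolding tendsto_iff by auto
    then have "infinite {n. \<not> dist (spectral_fun h (x n)) (spectral_fun h A) < \<epsilon>}" (is "infinite ?N")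
      unfolding not_eventually by (simp add: INFM_iff_infinite frequently_cofinite[symmetric] cofinite_eq_sequentially)
    then obtain r :: "nat \<Rightarrow> nat" where r: "strict_mono r" "\<And>n. r n \<in> ?N"
      using infinite_enumerate by blast
    have "\<forall>n. \<exists>P d. x (r n) = conj_diag P d \<and> orthogonal_matrix P \<and> (\<forall>i. d $ i \<in> U)"
      using x by (auto simp: mats_with_spectrum_def)
    then obtain P d where xr: "\<And>n. x (r n) = conj_diag (P n) (d n)"
      and P: "\<And>n. orthogonal_matrix (P n)" and d: "\<And>n i. d n $ i \<in> U"
      by metis
    have "bounded (range P)"
      using norm_orthogonal_matrix_le[OF P] by (auto simp: bounded_iff)
    then obtain Q s where s: "strict_mono s" and Q: "(P \<circ> s) \<longlonglongrightarrow> Q"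
      using bounded_imp_convergent_subsequence by blast
    have "(\<lambda>n. transpose (P (s n)) ** P (s n)) \<longlonglongrightarrow> transpose Q ** Q"
      using Q unfolding comp_def by (intro tendsto_intros)
    then have QO: "orthogonal_matrix Q"
      using P unfolding orthogonal_matrix by (simp add: LIMSEQ_const_iff)
    define e where "e = (\<chi> i. column i Q \<bullet> (A *v column i Q))"
    have xrs: "(\<lambda>n. x (r (s n))) \<longlonglongrightarrow> A"
      using LIMSEQ_subseq_LIMSEQ[OF LIMSEQ_subseq_LIMSEQ[OF lim r(1)] s] by (simp add: comp_def)
    have de: "(\<lambda>n. d (s n) $ i) \<longlonglongrightarrow> e $ i" for i
    proof -
      have "(\<lambda>n. column i (P (s n)) \<bullet> (x (r (s n)) *v column i (P (s n)))) \<longlonglongrightarrow> e $ i"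
        unfolding e_def vec_lambda_beta using Q xrs unfolding comp_def by (intro tendsto_intros)
      then show ?thesis by (simp add: xr eigenvector_column[OF P] column_unit[OF P])
    qed
    have "(\<lambda>n. conj_diag (P (s n)) (d (s n))) \<longlonglongrightarrow> conj_diag Q e"
      using Q de unfolding comp_def by (rule tendsto_conj_diag)
    then have AQ: "A = conj_diag Q e"
      using xrs LIMSEQ_unique unfolding xr by blast
    then have eU: "e $ i \<in> U" for i
      using A by (simp add: mats_with_spectrum_iff[OF QO])
    have "(\<lambda>n. h (d (s n) $ i)) \<longlonglongrightarrow> h (e $ i)" for i
      by (rule continuous_on_tendsto_compose[OF h de eU]) (simp add: d)
    then have "(\<lambda>n. conj_diag (P (s n)) (\<chi> i. h (d (s n) $ i))) \<longlonglongrightarrow> conj_diag Q (\<chi> i. h (e $ i))"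
      using Q unfolding comp_def by (intro tendsto_conj_diag) simp_all
    then have "(\<lambda>n. spectral_fun h (x (r (s n)))) \<longlonglongrightarrow> spectral_fun h A"
      by (simp add: xr AQ spectral_fun_conj_diag[OF P] spectral_fun_conj_diag[OF QO])
    then have "\<forall>\<^sub>F n in sequentially. dist (spectral_fun h (x (r (s n)))) (spectral_fun h A) < \<epsilon>"
      using \<epsilon> by (rule tendstoD)
    then obtain n where "dist (spectral_fun h (x (r (s n)))) (spectral_fun h A) < \<epsilon>"
      using eventually_sequentially by auto
    then show False using r(2)[of "s n"] by simp
  qed
qed

section \<open>The optimal transport matrix\<close>

lemma congruence_pos_semidef:
  assumes "transpose T = T" "M \<in> pos_semidef_mats"
  shows "T ** M ** T \<in> pos_semidef_mats"
proof -
  have "x \<bullet> (T ** M ** T *v x) = (T *v x) \<bullet> (M *v (T *v x))" for x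
    by (simp add: matrix_vector_mul_assoc[symmetric] symmetric_inner[OF assms(1)])
  then show ?thesis
    using assms by (simp add: pos_semidef_mats_def matrix_transpose_mul matrix_mul_assoc)
qed

lemma mat_sqrt_inverse:
  assumes "S \<in> pos_def_mats"
  shows "matrix_inv (mat_sqrt S) = spectral_fun (\<lambda>x. inverse (sqrt x)) S"
    "mat_sqrt S ** matrix_inv (mat_sqrt S) = mat 1" "matrix_inv (mat_sqrt S) ** mat_sqrt S = mat 1"
    "transpose (matrix_inv (mat_sqrt S)) = matrix_inv (mat_sqrt S)"
proof -
  obtain P d where P: "orthogonal_matrix P" and S: "S = conj_diag P d" and d: "\<And>i. 0 < d $ i"
    using assms by (rule spectral_theorem_pos_def) blast
  have d0: "d $ i \<noteq> 0" for i using d[of i] by simp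
  have T: "mat_sqrt S = conj_diag P (\<chi> i. sqrt (d $ i))"
    using mat_sqrt_pos_semidef(1)[OF pos_def_imp_semidef[OF assms]]
    by (simp add: S spectral_fun_conj_diag[OF P])
  have I: "matrix_inv (mat_sqrt S) = conj_diag P (\<chi> i. inverse (sqrt (d $ i)))"
    unfolding T by (subst matrix_inv_conj_diag[OF P]) (simp_all add: d0)
  show "matrix_inv (mat_sqrt S) = spectral_fun (\<lambda>x. inverse (sqrt x)) S"
    unfolding I by (simp add: S spectral_fun_conj_diag[OF P])
  show "mat_sqrt S ** matrix_inv (mat_sqrt S) = mat 1" "matrix_inv (mat_sqrt S) ** mat_sqrt S = mat 1"
    "transpose (matrix_inv (mat_sqrt S)) = matrix_inv (mat_sqrt S)"
    unfolding I unfolding T by (simp_all add: conj_diag_mult[OF P] d0 conj_diag_one[OF P] transpose_conj_diag)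
qed

lemma transport_mat_spec:
  assumes S0: "S0 \<in> pos_def_mats" and S1: "S1 \<in> pos_semidef_mats"
  shows "transport_mat S0 S1 \<in> pos_semidef_mats"
    and "transport_mat S0 S1 ** S0 ** transport_mat S0 S1 = S1"
proof -
  define T where "T = mat_sqrt S0"
  define W where "W = matrix_inv T"
  define M where "M = mat_sqrt (T ** S1 ** T)"
  have T: "T \<in> pos_semidef_mats" "T ** T = S0"
    using mat_sqrt_pos_semidef[OF pos_def_imp_semidef[OF S0]] by (auto simp: T_def)
  then have tT: "transpose T = T" by (simp add: pos_semidef_mats_def)
  have W: "T ** W = mat 1" "W ** T = mat 1" "transpose W = W"
    using mat_sqrt_inverse[OF S0] by (auto simp: T_def W_def)
  have M: "M \<in> pos_semidef_mats" "M ** M = T ** S1 ** T"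
    using mat_sqrt_pos_semidef[OF congruence_pos_semidef[OF tT S1]] by (auto simp: M_def)
  have R: "transport_mat S0 S1 = W ** M ** W"
    by (simp add: transport_mat_def T_def W_def M_def)
  show "transport_mat S0 S1 \<in> pos_semidef_mats"
    unfolding R by (rule congruence_pos_semidef[OF W(3) M(1)])
  have "W ** M ** W ** S0 ** (W ** M ** W) = W ** M ** (W ** T) ** (T ** W) ** M ** W"
    unfolding T(2)[symmetric] by (simp add: matrix_mul_assoc)
  also have "\<dots> = W ** (M ** M) ** W" by (simp add: W matrix_mul_assoc)
  also have "\<dots> = (W ** T) ** S1 ** (T ** W)" unfolding M(2) by (simp add: matrix_mul_assoc)
  finally show "transport_mat S0 S1 ** S0 ** transport_mat S0 S1 = S1"
    unfolding R by (simp add: W)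
qed

text \<open>With \<open>T\<close> the square root of \<open>S0\<close>, the matrix \<open>T R T\<close> is positive semidefinite with square
  \<open>T S1 T\<close>, so it is the inner square root in the definition of \<open>transport_mat\<close>.\<close>

lemma transport_mat_unique:
  assumes S0: "S0 \<in> pos_def_mats" and R: "R \<in> pos_semidef_mats" and eq: "R ** S0 ** R = S1"
  shows "transport_mat S0 S1 = R"
proof -
  define T where "T = mat_sqrt S0"
  define W where "W = matrix_inv T"
  have T: "T \<in> pos_semidef_mats" "T ** T = S0"
    using mat_sqrt_pos_semidef[OF pos_def_imp_semidef[OF S0]] by (auto simp: T_def)
  then have tT: "transpose T = T" by (simp add: pos_semidef_mats_def)
  have W: "T ** W = mat 1" "W ** T = mat 1"
    using mat_sqrt_inverse[OF S0] by (auto simp: T_def W_def)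
  have "(T ** R ** T) ** (T ** R ** T) = T ** S1 ** T"
    unfolding eq[symmetric] T(2)[symmetric] by (simp add: matrix_mul_assoc)
  then have "mat_sqrt (T ** S1 ** T) = T ** R ** T"
    by (rule mat_sqrt_unique[OF congruence_pos_semidef[OF tT R]])
  then have "transport_mat S0 S1 = W ** (T ** R ** T) ** W"
    by (simp add: transport_mat_def T_def W_def)
  also have "\<dots> = (W ** T) ** R ** (T ** W)" by (simp add: matrix_mul_assoc)
  finally show ?thesis by (simp add: W)
qed

text \<open>This trades one covariance for the other, both in the trace formula and in the estimate for
  degenerating \<open>S0\<close>.\<close>

lemma transport_eigen_quadratic:
  assumes P: "orthogonal_matrix P" and eq: "conj_diag P r ** S0 ** conj_diag P r = S1"
  shows "column i P \<bullet> (S1 *v column i P) = (r $ i)\<^sup>2 * (column i P \<bullet> (S0 *v column i P))"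
  unfolding eq[symmetric]
  by (simp add: matrix_vector_mul_assoc[symmetric] eigenvector_column[OF P] eigen_coordinate[OF P]
      matrix_vector_mult_scaleR power2_eq_square)

text \<open>On an eigenvector of eigenvalue zero the quadratic form of \<open>S1\<close> would vanish.\<close>

lemma transport_mat_pos_def:
  assumes S0: "S0 \<in> pos_def_mats" and S1: "S1 \<in> pos_def_mats"
  shows "transport_mat S0 S1 \<in> pos_def_mats"
proof -
  note R = transport_mat_spec[OF S0 pos_def_imp_semidef[OF S1]]
  obtain P r where P: "orthogonal_matrix P" and r: "transport_mat S0 S1 = conj_diag P r"
    "\<And>i. 0 \<le> r $ i"
    using R(1) by (rule spectral_theorem_pos_semidef) blast
  have "r $ i \<noteq> 0" for i
  proof
    assume "r $ i = 0"
    then have "column i P \<bullet> (S1 *v column i P) = 0"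
      using transport_eigen_quadratic[OF P R(2)[unfolded r(1)], of i] by simp
    moreover have "column i P \<noteq> 0" using column_unit[OF P, of i] by auto
    ultimately show False using S1 by (auto simp: pos_def_mats_def)
  qed
  then show ?thesis using r by (simp add: conj_diag_pos_def_iff[OF P] less_le)
qed

lemma continuous_on_mat_sqrt:
  assumes "continuous_on X f" "f ` X \<subseteq> pos_semidef_mats"
  shows "continuous_on X (\<lambda>x. mat_sqrt (f x))"
proof -
  have "continuous_on pos_semidef_mats (spectral_fun sqrt)"
    unfolding pos_semidef_mats_spectrum by (intro continuous_on_spectral_fun continuous_intros)
  then have "continuous_on pos_semidef_mats mat_sqrt"
    by (rule continuous_on_eq) (simp add: mat_sqrt_pos_semidef)
  then show ?thesis using assms by (rule continuous_on_compose2)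
qed

lemma continuous_on_mat_sqrt_inverse:
  assumes "continuous_on X f" "f ` X \<subseteq> pos_def_mats"
  shows "continuous_on X (\<lambda>x. matrix_inv (mat_sqrt (f x)))"
proof -
  have "continuous_on pos_def_mats (spectral_fun (\<lambda>x. inverse (sqrt x)))"
    unfolding pos_def_mats_spectrum by (intro continuous_on_spectral_fun continuous_intros) simp
  then have "continuous_on pos_def_mats (\<lambda>S. matrix_inv (mat_sqrt S))"
    by (rule continuous_on_eq) (simp add: mat_sqrt_inverse)
  then show ?thesis using assms by (rule continuous_on_compose2)
qed

lemma continuous_on_transport_mat:
  "continuous_on (pos_def_mats \<times> pos_semidef_mats) (\<lambda>(S0, S1). transport_mat S0 S1)"
proof -
  have "transpose (mat_sqrt S) = mat_sqrt S" if "S \<in> pos_def_mats" for S :: "real^'n^'n"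
    using mat_sqrt_pos_semidef(2)[OF pos_def_imp_semidef[OF that]] by (simp add: pos_semidef_mats_def)
  then show ?thesis
    unfolding transport_mat_def case_prod_unfold
    by (intro continuous_intros continuous_on_mat_sqrt continuous_on_mat_sqrt_inverse)
      (auto intro!: congruence_pos_semidef intro: pos_def_imp_semidef)
qed

section \<open>The scalar profiles\<close>

text \<open>The weight of the covariance part of the loss, and also the numerator of \<open>kappa_profile\<close>.\<close>

definition psi_profile :: "real \<Rightarrow> real" where
  "psi_profile r = chi_profile r - r\<^sup>2 + 1"

lemma entropy_nonneg: "0 < x \<Longrightarrow> 0 \<le> x * ln x - x + 1" for x :: real
proof -
  assume x: "0 < x"
  have "ln (1 / x) \<le> 1 / x - 1" using x by (intro ln_le_minus_one) simp
  then have "x * (- ln x) \<le> x * (1 / x - 1)" using x by (intro mult_left_mono) (simp_all add: ln_div)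
  then show ?thesis using x by (simp add: algebra_simps)
qed

lemma psi_profile_nonneg: "0 \<le> r \<Longrightarrow> 0 \<le> psi_profile r"
  using entropy_nonneg[of "r\<^sup>2"] by (auto simp: psi_profile_def chi_profile_def)

lemma kappa_profile_alt:
  "0 \<le> r \<Longrightarrow> r \<noteq> 1 \<Longrightarrow> kappa_profile r = psi_profile r / (r - 1)\<^sup>2"
  by (auto simp: kappa_profile_def psi_profile_def chi_profile_def)

text \<open>Multiplied by \<open>(r - 1)\<^sup>2\<close>, the claim is the entropy inequality again, now at \<open>r\<close> and not at
  \<open>r\<^sup>2\<close>.\<close>

lemma kappa_profile_ge_1:
  assumes "0 \<le> r"
  shows "1 \<le> kappa_profile r"
proof (cases "r = 0 \<or> r = 1")
  case False
  then have r: "0 < r" "r \<noteq> 1" using assms by auto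
  have "ln (r\<^sup>2) = 2 * ln r" using r by (simp add: ln_realpow)
  then have "psi_profile r - (r - 1)\<^sup>2 = 2 * r * (r * ln r - r + 1)"
    using r unfolding psi_profile_def chi_profile_def by (simp add: power2_eq_square algebra_simps)
  also have "\<dots> \<ge> 0" using entropy_nonneg[of r] r by simp
  finally show ?thesis using r by (simp add: kappa_profile_alt)
qed (auto simp: kappa_profile_def)

lemma continuous_on_chi_profile: "continuous_on {0..} chi_profile"
proof (clarsimp simp: continuous_on_eq_continuous_within)
  fix r :: real assume "0 \<le> r"
  show "continuous (at r within {0..}) chi_profile"
  proof (cases "r = 0")
    case True
    have "((\<lambda>r. r\<^sup>2 * ln (r\<^sup>2)) \<longlongrightarrow> 0) (at_right (0::real))" by real_asymp
    then have "(chi_profile \<longlongrightarrow> 0) (at_right 0)"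
      by (rule Lim_transform_eventually) (auto simp: chi_profile_def eventually_at_filter)
    then show ?thesis using True
      by (simp add: continuous_within chi_profile_def at_within_Ici_at_right)
  next
    case False
    then have "r > 0" using \<open>0 \<le> r\<close> by simp
    have "isCont (\<lambda>r. r\<^sup>2 * ln (r\<^sup>2)) r" using \<open>r > 0\<close> by (intro continuous_intros) auto
    moreover have "\<forall>\<^sub>F x in nhds r. x\<^sup>2 * ln (x\<^sup>2) = chi_profile x"
      using eventually_nhds_in_open[of "{0<..}" r] \<open>r > 0\<close>
      by (auto simp: chi_profile_def elim!: eventually_mono)
    ultimately have "isCont chi_profile r" by (simp add: isCont_cong)
    then show ?thesis by (rule continuous_at_imp_continuous_at_within)
  qed
qed

lemma continuous_on_kappa_profile: "continuous_on {0..} kappa_profile"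
proof -
  let ?q = "\<lambda>r. psi_profile r / (r - 1)\<^sup>2"
  have psi: "continuous_on {0..} psi_profile"
    unfolding psi_profile_def by (intro continuous_intros continuous_on_chi_profile)
  show ?thesis
  proof (clarsimp simp: continuous_on_eq_continuous_within)
    fix r :: real assume "0 \<le> r"
    show "continuous (at r within {0..}) kappa_profile"
    proof (cases "r = 1")
      case True
      have "((\<lambda>r. (r\<^sup>2 * ln (r\<^sup>2) - r\<^sup>2 + 1) / (r - 1)\<^sup>2) \<longlongrightarrow> 2) (at (1::real))" by real_asymp
      moreover have "\<forall>\<^sub>F r::real in at 1. (r\<^sup>2 * ln (r\<^sup>2) - r\<^sup>2 + 1) / (r - 1)\<^sup>2 = kappa_profile r"
        using eventually_at_in_open[of "{0<..}" "1::real"]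
        by (auto simp: kappa_profile_def elim!: eventually_mono)
      ultimately have "(kappa_profile \<longlongrightarrow> 2) (at 1)"
        by (rule Lim_transform_eventually)
      then have "isCont kappa_profile 1" by (simp add: continuous_within kappa_profile_def)
      then show ?thesis using True continuous_at_imp_continuous_at_within by blast
    next
      case False
      have "continuous (at r within {0..}) ?q"
        using psi \<open>0 \<le> r\<close> False
        by (intro continuous_intros) (auto simp: continuous_on_eq_continuous_within)
      moreover have "\<forall>\<^sub>F x in at r within {0..}. ?q x = kappa_profile x"
      proof -
        have "\<forall>\<^sub>F x in at r within {0..}. x \<in> {0..} - {r}"
          by (simp add: eventually_at_filter)
        moreover have "\<forall>\<^sub>F x in at r within {0..}. x \<noteq> 1"
          using False t1_space_nhds[of r 1] by (simp add: eventually_at_filter eventually_mono)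
        ultimately show ?thesis
          by eventually_elim (auto simp: kappa_profile_alt)
      qed
      ultimately have "(kappa_profile \<longlongrightarrow> ?q r) (at r within {0..})"
        unfolding continuous_within by (rule Lim_transform_eventually)
      then show ?thesis
        using False \<open>0 \<le> r\<close> by (simp add: continuous_within kappa_profile_alt)
    qed
  qed
qed

section \<open>Linear changes of variables for Lebesgue measure\<close>

lemma measurable_matrix_vector_mult [measurable]:
  fixes A :: "real^'n^'m"
  shows "(\<lambda>x. A *v x) \<in> borel_measurable borel"
  by (intro borel_measurable_continuous_onI linear_continuous_on
      linear_conv_bounded_linear[THEN iffD1]) simp

lemma emeasure_lborel_vimage_plus:
  fixes c :: "'a::euclidean_space"
  assumes [measurable]: "A \<in> sets borel"
  shows "emeasure lborel {x. c + x \<in> A} = emeasure lborel A"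
proof -
  have "emeasure (distr lborel borel ((+) c)) A = emeasure lborel {x. c + x \<in> A}"
    by (subst emeasure_distr) (auto simp: vimage_def)
  then show ?thesis by (simp add: lborel_distr_plus)
qed

text \<open>The uniqueness argument for Haar measure. The image measure is translation invariant because \<open>P\<close>
  is linear. Integrating \<open>1\<^sub>B x * 1\<^sub>C (x + P z)\<close> in both orders compares it with Lebesgue measure up
  to the volume of \<open>B\<close>, and for a ball \<open>B\<close> this volume is the same on both sides because \<open>P\<close> is an
  isometry.\<close>

lemma lborel_distr_orthogonal:
  fixes P :: "real^'n^'n"
  assumes P: "orthogonal_matrix P"
  shows "distr lborel borel (\<lambda>x. P *v x) = lborel"
proof (rule measure_eqI)
  fix C :: "(real^'n) set" assume "C \<in> sets (distr lborel borel (\<lambda>x. P *v x))"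
  then have C [measurable]: "C \<in> sets borel" by simp
  define Q where "Q = transpose P"
  have Q [simp]: "P *v (Q *v x) = x" for x
    using P by (simp add: Q_def orthogonal_matrix_def matrix_vector_mul_assoc del: transpose_matrix_vector)
  define B where "B = cball (0 :: real^'n) 1"
  have [measurable]: "B \<in> sets borel" by (simp add: B_def)
  have dist_P: "norm (P *v y) = norm y" for y
    using P by (metis matrix_of_matrix_vector_mul matrix_vector_mul_linear
        orthogonal_transformation_matrix orthogonal_transformation_norm)
  let ?g = "\<lambda>x z. indicator B x * indicator C (x + P *v z) :: ennreal"
  \<comment> \<open>Both iterated integrals of \<open>?g\<close> are products of volumes.\<close>
  have "(\<integral>\<^sup>+x. \<integral>\<^sup>+z. ?g x z \<partial>lborel \<partial>lborel) = (\<integral>\<^sup>+x. indicator B x * emeasure lborel {z. P *v z \<in> C} \<partial>lborel)"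
  proof (rule nn_integral_cong)
    fix x
    have "(\<lambda>z. indicator C (x + P *v z) :: ennreal) = indicator {z. x + P *v z \<in> C}"
      by (auto simp: indicator_def)
    then have "(\<integral>\<^sup>+z. indicator C (x + P *v z) \<partial>lborel) = emeasure lborel {z. x + P *v z \<in> C}"
      by simp
    also have "{z. x + P *v z \<in> C} = {z. Q *v x + z \<in> {z. P *v z \<in> C}}"
      by (simp add: matrix_vector_right_distrib)
    also have "emeasure lborel \<dots> = emeasure lborel {z. P *v z \<in> C}"
      by (rule emeasure_lborel_vimage_plus) measurable
    finally show "(\<integral>\<^sup>+z. ?g x z \<partial>lborel) = indicator B x * emeasure lborel {z. P *v z \<in> C}"
      by (subst nn_integral_cmult) auto
  qed
  also have "\<dots> = emeasure lborel B * emeasure lborel {z. P *v z \<in> C}"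
    by (subst nn_integral_multc) auto
  finally have 1: "(\<integral>\<^sup>+x. \<integral>\<^sup>+z. ?g x z \<partial>lborel \<partial>lborel) = emeasure lborel B * emeasure lborel {z. P *v z \<in> C}" .
  have "(\<integral>\<^sup>+x. \<integral>\<^sup>+z. ?g x z \<partial>lborel \<partial>lborel) = (\<integral>\<^sup>+z. \<integral>\<^sup>+x. ?g x z \<partial>lborel \<partial>lborel)"
    by (rule lborel_pair.Fubini'[symmetric]) measurable
  also have "\<dots> = (\<integral>\<^sup>+z. \<integral>\<^sup>+x. indicator B (x - P *v z) * indicator C x \<partial>lborel \<partial>lborel)"
  proof (rule nn_integral_cong)
    fix z
    have "(\<integral>\<^sup>+x. indicator B (x - P *v z) * indicator C x \<partial>lborel)
      = (\<integral>\<^sup>+x. indicator B (x - P *v z) * indicator C x \<partial>distr lborel borel ((+) (P *v z)))"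
      by (simp only: lborel_distr_plus)
    also have "\<dots> = (\<integral>\<^sup>+x. ?g x z \<partial>lborel)"
      by (subst nn_integral_distr) (auto simp: add.commute)
    finally show "(\<integral>\<^sup>+x. ?g x z \<partial>lborel) = (\<integral>\<^sup>+x. indicator B (x - P *v z) * indicator C x \<partial>lborel)" ..
  qed
  also have "\<dots> = (\<integral>\<^sup>+x. \<integral>\<^sup>+z. indicator B (x - P *v z) * indicator C x \<partial>lborel \<partial>lborel)"
    by (rule lborel_pair.Fubini') measurable
  also have "\<dots> = (\<integral>\<^sup>+x. emeasure lborel B * indicator C x \<partial>lborel)"
  proof (rule nn_integral_cong)
    fix x
    have "x - P *v z \<in> B \<longleftrightarrow> z \<in> cball (Q *v x) 1" for z
    proof -
      have "x - P *v z = P *v (Q *v x - z)" by (simp add: matrix_vector_mult_diff_distrib)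
      then have "norm (x - P *v z) = norm (Q *v x - z)" by (simp only: dist_P)
      then show ?thesis by (simp add: B_def dist_norm norm_minus_commute)
    qed
    then have "(\<integral>\<^sup>+z. indicator B (x - P *v z) \<partial>lborel) = (\<integral>\<^sup>+z. indicator (cball (Q *v x) 1) z \<partial>lborel)"
      by (intro nn_integral_cong) (simp add: indicator_def)
    also have "\<dots> = emeasure lborel B"
      by (simp add: B_def emeasure_cball)
    finally show "(\<integral>\<^sup>+z. indicator B (x - P *v z) * indicator C x \<partial>lborel) = emeasure lborel B * indicator C x"
      by (subst nn_integral_multc) auto
  qed
  also have "\<dots> = emeasure lborel B * emeasure lborel C"
    by (subst nn_integral_cmult) auto
  finally have "emeasure lborel B * emeasure lborel {z. P *v z \<in> C} = emeasure lborel B * emeasure lborel C"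
    using 1 by simp
  moreover have "emeasure lborel B \<noteq> 0" "emeasure lborel B \<noteq> \<infinity>"
    using less_imp_neq[OF unit_ball_vol_pos[of "real CARD('n)"]] by (simp_all add: B_def emeasure_cball)
  ultimately have "emeasure lborel {z. P *v z \<in> C} = emeasure lborel C"
    by (simp add: ennreal_mult_cancel_left)
  then show "emeasure (distr lborel borel (\<lambda>x. P *v x)) C = emeasure lborel C"
    by (subst emeasure_distr) (auto simp: vimage_def)
qed simp

lemma Basis_cart: "(Basis :: (real^'n) set) = (\<lambda>i. axis i 1) ` UNIV"
  by (auto simp: Basis_vec_def)

lemma prod_Basis_cart: "(\<Prod>b\<in>(Basis :: (real^'n) set). f b) = (\<Prod>i\<in>UNIV. f (axis i 1))"
  unfolding Basis_cart by (subst prod.reindex) (auto simp: inj_on_def axis_eq_axis)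

lemma sum_Basis_cart: "(\<Sum>b\<in>(Basis :: (real^'n) set). f b) = (\<Sum>i\<in>UNIV. f (axis i 1))"
  unfolding Basis_cart by (subst sum.reindex) (auto simp: inj_on_def axis_eq_axis)

lemma nn_integral_lborel_diagonal:
  fixes d :: "real^'n"
  assumes d: "\<And>i. d $ i \<noteq> 0" and [measurable]: "g \<in> borel_measurable borel"
  shows "(\<integral>\<^sup>+x. g x \<partial>lborel) = ennreal (\<Prod>i\<in>UNIV. \<bar>d $ i\<bar>) * (\<integral>\<^sup>+x. g (diag_mat d *v x) \<partial>lborel)"
proof -
  have T: "(0 :: real^'n) + (\<Sum>j\<in>Basis. ((d \<bullet> j) * (x \<bullet> j)) *\<^sub>R j) = diag_mat d *v x" for x
    unfolding sum_Basis_cart inner_axis diag_mat_mult_vector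
    by (simp add: vec_eq_iff axis_def if_distrib cong: if_cong)
  have "lborel = density (distr lborel borel (\<lambda>x. 0 + (\<Sum>j\<in>Basis. ((d \<bullet> j) * (x \<bullet> j)) *\<^sub>R j)))
      (\<lambda>_. ennreal (\<Prod>j\<in>Basis. \<bar>d \<bullet> j\<bar>))"
    using d by (intro lborel_affine_euclidean) (auto simp: Basis_cart inner_axis)
  then have L: "lborel = density (distr lborel borel (\<lambda>x. diag_mat d *v x)) (\<lambda>_. ennreal (\<Prod>i\<in>UNIV. \<bar>d $ i\<bar>))"
    unfolding T by (simp add: prod_Basis_cart inner_axis)
  have "(\<integral>\<^sup>+x. g x \<partial>lborel) = (\<integral>\<^sup>+x. g x \<partial>density (distr lborel borel (\<lambda>x. diag_mat d *v x)) (\<lambda>_. ennreal (\<Prod>i\<in>UNIV. \<bar>d $ i\<bar>)))"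
    by (subst L) (rule refl)
  also have "\<dots> = ennreal (\<Prod>i\<in>UNIV. \<bar>d $ i\<bar>) * (\<integral>\<^sup>+x. g (diag_mat d *v x) \<partial>lborel)"
    by (simp add: nn_integral_density nn_integral_cmult nn_integral_distr)
  finally show ?thesis .
qed

text \<open>The two orthogonal factors preserve the integral; the diagonal one between them contributes the
  determinant.\<close>

lemma nn_integral_lborel_affine:
  fixes P :: "real^'n^'n"
  assumes P: "orthogonal_matrix P" and d: "\<And>i. d $ i \<noteq> 0" and g [measurable]: "g \<in> borel_measurable borel"
  shows "(\<integral>\<^sup>+x. g x \<partial>lborel) = ennreal \<bar>det (conj_diag P d)\<bar> * (\<integral>\<^sup>+x. g (c + conj_diag P d *v x) \<partial>lborel)"
proof -
  have rot: "(\<integral>\<^sup>+x. f x \<partial>lborel) = (\<integral>\<^sup>+x. f (U *v x) \<partial>lborel)"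
    if "orthogonal_matrix U" and [measurable]: "f \<in> borel_measurable borel" for U :: "real^'n^'n" and f
  proof -
    have "(\<integral>\<^sup>+x. f x \<partial>lborel) = (\<integral>\<^sup>+x. f x \<partial>distr lborel borel (\<lambda>x. U *v x))"
      by (simp only: lborel_distr_orthogonal[OF that(1)])
    then show ?thesis by (simp add: nn_integral_distr)
  qed
  have "(\<integral>\<^sup>+x. g x \<partial>lborel) = (\<integral>\<^sup>+x. g x \<partial>distr lborel borel ((+) c))"
    by (simp only: lborel_distr_plus)
  also have "\<dots> = (\<integral>\<^sup>+x. g (c + x) \<partial>lborel)" by (simp add: nn_integral_distr)
  also have "\<dots> = (\<integral>\<^sup>+x. g (c + P *v x) \<partial>lborel)" by (rule rot[OF P]) measurable
  also have "\<dots> = ennreal (\<Prod>i\<in>UNIV. \<bar>d $ i\<bar>) * (\<integral>\<^sup>+x. g (c + P *v (diag_mat d *v x)) \<partial>lborel)"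
    by (rule nn_integral_lborel_diagonal[OF d]) measurable
  also have "(\<integral>\<^sup>+x. g (c + P *v (diag_mat d *v x)) \<partial>lborel) =
      (\<integral>\<^sup>+x. g (c + P *v (diag_mat d *v (transpose P *v x))) \<partial>lborel)"
    using P by (intro rot) (simp_all, measurable)
  also have "\<dots> = (\<integral>\<^sup>+x. g (c + conj_diag P d *v x) \<partial>lborel)"
    by (simp only: conj_diag_def matrix_vector_mul_assoc matrix_mul_assoc)
  finally show ?thesis by (simp add: det_conj_diag[OF P] abs_prod)
qed

text \<open>Lebesgue measure is the product of its coordinates, so Fubini applies.\<close>

lemma integral_lborel_prod_cart:
  fixes f :: "'n::finite \<Rightarrow> real \<Rightarrow> real"
  assumes f: "\<And>i. integrable lborel (f i)"
  shows "has_bochner_integral lborel (\<lambda>x::real^'n. \<Prod>i\<in>UNIV. f i (x $ i)) (\<Prod>i\<in>UNIV. integral\<^sup>L lborel (f i))"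
proof -
  interpret product_sigma_finite "\<lambda>_ :: real^'n. lborel :: real measure"
    by standard
  have [measurable]: "f i \<in> borel_measurable borel" for i using f[of i] by simp
  let ?F = "\<lambda>x::real^'n. \<Prod>i\<in>UNIV. f i (x $ i)"
  have comp: "(\<Sum>b\<in>Basis. y b *\<^sub>R b) $ i = y (axis i 1)" for y and i :: 'n
    by (simp add: sum_Basis_cart axis_def if_distrib cong: if_cong)
  have F: "?F (\<Sum>b\<in>Basis. y b *\<^sub>R b) = (\<Prod>b\<in>Basis. f (axis_index b) (y b))" for y :: "real^'n \<Rightarrow> real"
    by (simp only: prod_Basis_cart comp axis_index_axis)
  have "integrable (Pi\<^sub>M Basis (\<lambda>_::real^'n. lborel)) (\<lambda>y. \<Prod>b\<in>Basis. f (axis_index b) (y b))"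
    by (rule product_integrable_prod) (simp_all add: f)
  moreover have "(\<integral>y. (\<Prod>b\<in>Basis. f (axis_index b) (y b)) \<partial>Pi\<^sub>M Basis (\<lambda>_::real^'n. lborel))
      = (\<Prod>b\<in>(Basis :: (real^'n) set). integral\<^sup>L lborel (f (axis_index b)))"
    by (rule product_integral_prod) (simp_all add: f)
  ultimately have "has_bochner_integral (Pi\<^sub>M Basis (\<lambda>_::real^'n. lborel))
      (\<lambda>y. ?F (\<Sum>b\<in>Basis. y b *\<^sub>R b)) (\<Prod>i\<in>UNIV. integral\<^sup>L lborel (f i))"
    unfolding F by (simp add: has_bochner_integral_iff prod_Basis_cart)
  then show ?thesis
    by (subst lborel_eq) (rule has_bochner_integral_distr, measurable)
qed

section \<open>Gaussian measures\<close>

lemma sets_gaussian [simp, measurable_cong]: "sets (gaussian m S) = sets borel"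
  by (simp add: gaussian_def)

lemma gaussian_standard:
  "gaussian 0 (mat 1 :: real^'n^'n) = density lborel (\<lambda>x. ennreal (\<Prod>i\<in>UNIV. std_normal_density (x $ i)))"
proof -
  have "exp (- ((x - 0) \<bullet> (matrix_inv (mat 1) *v (x - 0))) / 2) / sqrt ((2 * pi) ^ CARD('n) * det (mat 1 :: real^'n^'n))
    = (\<Prod>i\<in>UNIV. std_normal_density (x $ i))" for x :: "real^'n"
  proof -
    have "matrix_inv (mat 1 :: real^'n^'n) = mat 1" by (rule matrix_inv_unique) simp
    moreover have "exp (- (x \<bullet> x) / 2) = (\<Prod>i\<in>UNIV. exp (- (x $ i)\<^sup>2 / 2))"
      by (simp add: inner_vec_def exp_sum[symmetric] sum_negf sum_divide_distrib power2_eq_square)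
    moreover have "(\<Prod>i\<in>UNIV. std_normal_density (x $ i)) =
        (1 / sqrt (2 * pi)) ^ CARD('n) * (\<Prod>i\<in>UNIV. exp (- (x $ i)\<^sup>2 / 2))"
      unfolding std_normal_density_def prod.distrib prod_constant by (rule refl)
    moreover have "(1 / sqrt (2 * pi)) ^ CARD('n) = 1 / sqrt ((2 * pi) ^ CARD('n))"
      by (simp only: real_sqrt_power power_divide power_one)
    ultimately show ?thesis by simp
  qed
  then show ?thesis by (simp add: gaussian_def)
qed

lemma standard_gaussian_monomial:
  fixes f :: "'n::finite \<Rightarrow> real \<Rightarrow> real"
  assumes f: "\<And>i. has_bochner_integral lborel (\<lambda>x. std_normal_density x * f i x) (c i)"
    and [measurable]: "\<And>i. f i \<in> borel_measurable borel"
  shows "has_bochner_integral (gaussian 0 (mat 1 :: real^'n^'n)) (\<lambda>z. \<Prod>i\<in>UNIV. f i (z $ i)) (\<Prod>i\<in>UNIV. c i)"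
proof -
  have "has_bochner_integral lborel (\<lambda>z::real^'n. \<Prod>i\<in>UNIV. std_normal_density (z $ i) * f i (z $ i))
    (\<Prod>i\<in>UNIV. integral\<^sup>L lborel (\<lambda>x. std_normal_density x * f i x))"
    using f by (intro integral_lborel_prod_cart) (auto simp: has_bochner_integral_iff)
  then show ?thesis
    using f unfolding gaussian_standard
    by (intro has_bochner_integral_density) (auto simp: prod.distrib has_bochner_integral_iff prod_nonneg)
qed

lemma std_normal_moments:
  "has_bochner_integral lborel std_normal_density 1"
  "has_bochner_integral lborel (\<lambda>x. std_normal_density x * x) 0"
  "has_bochner_integral lborel (\<lambda>x. std_normal_density x * (x * x)) 1"
  using std_normal_moment_even[of 0] std_normal_moment_odd[of 0] std_normal_moment_even[of 1]
  by (simp_all add: power2_eq_square)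

lemma standard_gaussian_moments:
  fixes i j :: "'n::finite"
  defines "\<gamma> \<equiv> gaussian 0 (mat 1 :: real^'n^'n)"
  shows "has_bochner_integral \<gamma> (\<lambda>z. 1) (1 :: real)" "has_bochner_integral \<gamma> (\<lambda>z. z $ i) 0"
    "has_bochner_integral \<gamma> (\<lambda>z. z $ i * z $ j) (if i = j then 1 else 0)"
proof -
  show "has_bochner_integral \<gamma> (\<lambda>z. 1) (1 :: real)"
    using standard_gaussian_monomial[of "\<lambda>_ _. 1" "\<lambda>_. 1"] std_normal_moments
    by (simp add: \<gamma>_def)
  have "has_bochner_integral \<gamma> (\<lambda>z. \<Prod>k\<in>UNIV. if k = i then z $ k else 1) (\<Prod>k\<in>UNIV. if k = i then 0 else 1)"
    unfolding \<gamma>_def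
    by (rule standard_gaussian_monomial[of "\<lambda>k x. if k = i then x else 1"])
      (use std_normal_moments in auto)
  then show "has_bochner_integral \<gamma> (\<lambda>z. z $ i) 0" by simp
  have "has_bochner_integral \<gamma> (\<lambda>z. \<Prod>k\<in>UNIV. (if k = i then z $ k else 1) * (if k = j then z $ k else 1))
      (\<Prod>k\<in>UNIV. if k = i then (if k = j then 1 else 0) else (if k = j then 0 else 1))"
    unfolding \<gamma>_def
    by (rule standard_gaussian_monomial[of "\<lambda>k x. (if k = i then x else 1) * (if k = j then x else 1)"])
      (use std_normal_moments in auto)
  moreover have "(\<Prod>k\<in>UNIV. if k = i then (if k = j then 1 else 0) else (if k = j then 0 else 1))
      = (if i = j then 1 else (0::real))"
    by (cases "i = j") (auto intro!: prod_zero[of UNIV] prod.neutral bexI[of _ i])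
  ultimately show "has_bochner_integral \<gamma> (\<lambda>z. z $ i * z $ j) (if i = j then 1 else 0)"
    by (simp add: prod.distrib)
qed

lemma standard_gaussian_square:
  fixes w :: "real^'n"
  shows "has_bochner_integral (gaussian 0 (mat 1)) (\<lambda>z. (a + w \<bullet> z)\<^sup>2) (a\<^sup>2 + w \<bullet> w)"
proof -
  have "(a + w \<bullet> z)\<^sup>2 = a\<^sup>2 * 1 + 2 * a * (\<Sum>i\<in>UNIV. w $ i * z $ i)
      + (\<Sum>i\<in>UNIV. \<Sum>j\<in>UNIV. w $ i * w $ j * (z $ i * z $ j))" for z
    by (simp add: inner_vec_def power2_sum power2_eq_square sum_product algebra_simps)
  moreover have "a\<^sup>2 + w \<bullet> w = a\<^sup>2 * 1 + 2 * a * (\<Sum>i\<in>UNIV. w $ i * 0)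
      + (\<Sum>i\<in>UNIV. \<Sum>j\<in>UNIV. w $ i * w $ j * (if i = j then 1 else 0))"
    by (simp add: inner_vec_def if_distrib cong: if_cong)
  moreover have "has_bochner_integral (gaussian 0 (mat 1))
     (\<lambda>z. a\<^sup>2 * 1 + 2 * a * (\<Sum>i\<in>UNIV. w $ i * z $ i)
      + (\<Sum>i\<in>UNIV. \<Sum>j\<in>UNIV. w $ i * w $ j * (z $ i * z $ j)))
     (a\<^sup>2 * 1 + 2 * a * (\<Sum>i\<in>UNIV. w $ i * 0)
      + (\<Sum>i\<in>UNIV. \<Sum>j\<in>UNIV. w $ i * w $ j * (if i = j then 1 else 0)))"
    by (intro has_bochner_integral_add has_bochner_integral_mult_right has_bochner_integral_sum
        standard_gaussian_moments)
  ultimately show ?thesis by simp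
qed

text \<open>The Jacobian \<open>det R\<close> is exactly the ratio of the two normalising constants, and the symmetry of
  \<open>R\<close> turns one exponent into the other.\<close>

lemma gaussian_affine_image:
  fixes P :: "real^'n^'n"
  assumes S: "S \<in> pos_def_mats" and P: "orthogonal_matrix P" and r: "\<And>i. 0 < r $ i"
  defines "R \<equiv> conj_diag P r"
  shows "distr (gaussian m S) borel (\<lambda>x. c + R *v x) = gaussian (c + R *v m) (R ** S ** R)"
proof (rule measure_eqI)
  fix A :: "(real^'n) set" assume "A \<in> sets (distr (gaussian m S) borel (\<lambda>x. c + R *v x))"
  then have [measurable]: "A \<in> sets borel" by simp
  obtain Q d where Q: "orthogonal_matrix Q" "S = conj_diag Q d" "\<And>i. 0 < d $ i"
    using S by (rule spectral_theorem_pos_def) blast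
  have r0: "r $ i \<noteq> 0" "d $ i \<noteq> 0" for i using r[of i] Q(3)[of i] by auto
  define I where "I = conj_diag P (\<chi> i. inverse (r $ i))"
  define J where "J = matrix_inv S"
  have RI: "R ** I = mat 1" "I ** R = mat 1"
    by (simp_all add: R_def I_def conj_diag_mult[OF P] r0 conj_diag_one[OF P])
  have SJ: "S ** J = mat 1"
    unfolding J_def Q(2) by (simp add: matrix_inv_conj_diag[OF Q(1)] r0 conj_diag_mult[OF Q(1)] conj_diag_one[OF Q(1)])
  have detR: "0 < det R" by (simp add: R_def det_conj_diag[OF P] prod_pos r)
  have detS: "0 < det S" by (simp add: Q det_conj_diag[OF Q(1)] prod_pos)
  have tR: "transpose R = R" by (simp add: R_def transpose_conj_diag)
  have inv: "matrix_inv (R ** S ** R) = I ** J ** I"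
  proof (rule matrix_inv_unique)
    have "R ** S ** R ** (I ** J ** I) = R ** S ** (R ** I) ** J ** I" by (simp add: matrix_mul_assoc)
    also have "\<dots> = R ** (S ** J) ** I" by (simp add: RI matrix_mul_assoc)
    finally show "R ** S ** R ** (I ** J ** I) = mat 1" by (simp add: SJ RI)
  qed
  let ?N = "(2 * pi) ^ CARD('n)"
  define g0 where "g0 x = exp (- ((x - m) \<bullet> (J *v (x - m))) / 2) / sqrt (?N * det S)" for x
  define g1 where "g1 y = exp (- ((y - (c + R *v m)) \<bullet> (I ** J ** I *v (y - (c + R *v m)))) / 2)
      / sqrt (?N * det (R ** S ** R))" for y
  have [measurable]: "g0 \<in> borel_measurable borel" "g1 \<in> borel_measurable borel"
    unfolding g0_def g1_def by measurable
  have g: "det R * g1 (c + R *v x) = g0 x" for x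
  proof -
    have "c + R *v x - (c + R *v m) = R *v (x - m)" by (simp add: matrix_vector_mult_diff_distrib)
    moreover have "(R *v y) \<bullet> (I ** J ** I *v (R *v y)) = y \<bullet> (J *v y)" for y
    proof -
      have "(R *v y) \<bullet> (I ** J ** I *v (R *v y)) = y \<bullet> ((R ** I) ** J ** (I ** R) *v y)"
        unfolding symmetric_inner[OF tR] by (simp add: matrix_vector_mul_assoc matrix_mul_assoc)
      then show ?thesis by (simp add: RI)
    qed
    moreover have "sqrt (?N * det (R ** S ** R)) = det R * sqrt (?N * det S)"
      using detR by (simp add: det_mul real_sqrt_mult)
    ultimately show ?thesis
      using detR by (simp add: g0_def g1_def)
  qed
  have "emeasure (gaussian (c + R *v m) (R ** S ** R)) A = (\<integral>\<^sup>+y. ennreal (g1 y) * indicator A y \<partial>lborel)"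
    unfolding gaussian_def inv g1_def[symmetric] by (simp add: emeasure_density)
  also have "\<dots> = ennreal \<bar>det R\<bar> * (\<integral>\<^sup>+x. ennreal (g1 (c + R *v x)) * indicator A (c + R *v x) \<partial>lborel)"
    unfolding R_def by (rule nn_integral_lborel_affine[OF P r0(1)]) measurable
  also have "\<dots> = (\<integral>\<^sup>+x. ennreal (g0 x) * indicator A (c + R *v x) \<partial>lborel)"
    using detR by (subst nn_integral_cmult[symmetric])
      (auto simp: g[symmetric] ennreal_mult' mult.assoc intro!: nn_integral_cong)
  also have "\<dots> = emeasure (gaussian m S) {x. c + R *v x \<in> A}"
    unfolding gaussian_def J_def[symmetric] g0_def[symmetric]
    by (subst emeasure_density) (auto simp: indicator_def intro!: nn_integral_cong)
  also have "\<dots> = emeasure (distr (gaussian m S) borel (\<lambda>x. c + R *v x)) A"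
    by (subst emeasure_distr) (auto simp: vimage_def space_density gaussian_def)
  finally show "emeasure (distr (gaussian m S) borel (\<lambda>x. c + R *v x)) A =
     emeasure (gaussian (c + R *v m) (R ** S ** R)) A" ..
qed simp

text \<open>Squares of affine functionals suffice for everything that follows: the energy is a combination of
  them, and they determine the mean and the covariance.\<close>

lemma gaussian_square:
  fixes u :: "real^'n"
  assumes S: "S \<in> pos_def_mats"
  shows "has_bochner_integral (gaussian m S) (\<lambda>x. (a + u \<bullet> (x - m))\<^sup>2) (a\<^sup>2 + u \<bullet> (S *v u))"
proof -
  obtain P d where P: "orthogonal_matrix P" and S: "S = conj_diag P d" and d: "\<And>i. 0 < d $ i"
    using S by (rule spectral_theorem_pos_def) blast
  let ?T = "conj_diag P (\<chi> i. sqrt (d $ i))"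
  have T: "transpose ?T = ?T" "?T ** ?T = S"
    using d by (simp_all add: transpose_conj_diag S conj_diag_mult[OF P] less_imp_le)
  have "mat 1 \<in> (pos_def_mats :: (real^'n^'n) set)" by (simp add: pos_def_mats_def)
  then have G: "gaussian m S = distr (gaussian 0 (mat 1)) borel (\<lambda>z. m + ?T *v z)"
    using gaussian_affine_image[OF _ P, of "mat 1" "\<chi> i. sqrt (d $ i)" 0 m] d T by simp
  have "u \<bullet> (?T *v z) = (?T *v u) \<bullet> z" for z
    by (simp add: symmetric_inner[OF T(1)])
  moreover have "(?T *v u) \<bullet> (?T *v u) = u \<bullet> (S *v u)"
    by (simp add: symmetric_inner[OF T(1)] matrix_vector_mul_assoc T(2))
  ultimately show ?thesis
    unfolding G using standard_gaussian_square[of a "?T *v u"]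
    by (intro has_bochner_integral_distr) auto
qed

text \<open>As a polynomial in \<open>a\<close>, the integral of \<open>(a + u \<bullet> (x - m))\<^sup>2\<close> reveals the mean through its linear
  coefficient and the covariance, after polarisation, through its constant term.\<close>

lemma gaussian_inject:
  fixes S S' :: "real^'n^'n"
  assumes S: "S \<in> pos_def_mats" "S' \<in> pos_def_mats" and eq: "gaussian m S = gaussian m' S'"
  shows "m = m'" "S = S'"
proof -
  have *: "a\<^sup>2 + u \<bullet> (S *v u) = (a + u \<bullet> (m' - m))\<^sup>2 + u \<bullet> (S' *v u)" for a u
  proof -
    have shift: "(a + u \<bullet> (m' - m)) + u \<bullet> (x - m') = a + u \<bullet> (x - m)" for x
      by (simp add: inner_diff_right)
    have "has_bochner_integral (gaussian m S) (\<lambda>x. (a + u \<bullet> (x - m))\<^sup>2)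
        ((a + u \<bullet> (m' - m))\<^sup>2 + u \<bullet> (S' *v u))"
      using gaussian_square[OF S(2), of m' "a + u \<bullet> (m' - m)" u] unfolding eq shift .
    then show ?thesis by (rule has_bochner_integral_eq[OF gaussian_square[OF S(1)]])
  qed
  have "u \<bullet> (m' - m) = 0" for u
    using *[of 1 u] *[of 0 u] by (simp add: power2_sum)
  then have "m' - m = 0" by (metis inner_eq_zero_iff)
  then show "m = m'" by simp
  then have q: "u \<bullet> (S *v u) = u \<bullet> (S' *v u)" for u using *[of 0 u] by simp
  have sym: "(S *v x) \<bullet> y = x \<bullet> (S *v y)" "(S' *v x) \<bullet> y = x \<bullet> (S' *v y)" for x y
    using S by (auto intro!: symmetric_inner simp: pos_def_mats_def)
  have "x \<bullet> (S *v y) = x \<bullet> (S' *v y)" for x y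
    using q[of "x + y"] q[of x] q[of y] sym[of y x]
    by (simp add: matrix_vector_right_distrib inner_add_left inner_add_right inner_commute)
  then have "S *v y = S' *v y" for y using vector_eq_ldot by blast
  then show "S = S'" by (simp add: matrix_eq)
qed

section \<open>Gradient flows of quadratic potentials\<close>

definition quad_potential :: "real^'n^'n \<Rightarrow> real^'n \<Rightarrow> real^'n \<Rightarrow> real" where
  "quad_potential A b = (\<lambda>x. (x \<bullet> (A *v x)) / 2 + b \<bullet> x)"

text \<open>\<open>\<integral>\<^sub>0\<^sup>t e\<^sup>s\<^sup>a ds\<close>, the solution of \<open>y' = a y + 1\<close> with \<open>y 0 = 0\<close>.\<close>

definition exp_mean :: "real \<Rightarrow> real \<Rightarrow> real" where
  "exp_mean t a = (if a = 0 then t else (exp (t * a) - 1) / a)"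

definition quad_flow :: "real^'n^'n \<Rightarrow> real^'n \<Rightarrow> real^'n \<Rightarrow> real \<Rightarrow> real^'n \<Rightarrow> real^'n" where
  "quad_flow P a b t x =
     conj_diag P (\<chi> i. exp_mean t (a $ i)) *v b + conj_diag P (\<chi> i. exp (t * a $ i)) *v x"

lemma exp_mean_eq: "a * exp_mean t a = exp (t * a) - 1"
  by (simp add: exp_mean_def)

text \<open>Along a scalar flow the velocity \<open>a y + \<beta>\<close> is multiplied by \<open>e\<^sup>t\<^sup>a\<close>.\<close>

lemma scalar_flow_speed:
  "a * (exp_mean t a * \<beta> + exp (t * a) * y) + \<beta> = exp (t * a) * (a * y + \<beta>)"
proof -
  have "a * (exp_mean t a * \<beta> + exp (t * a) * y) + \<beta>
      = (a * exp_mean t a) * \<beta> + exp (t * a) * (a * y) + \<beta>" by (simp add: algebra_simps)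
  then show ?thesis unfolding exp_mean_eq by (simp add: algebra_simps)
qed

lemma exp_mean_0 [simp]: "exp_mean 0 a = 0"
  by (simp add: exp_mean_def)

lemma exp_mean_1_pos: "0 < exp_mean 1 a"
  by (auto simp: exp_mean_def zero_less_divide_iff not_less_iff_gr_or_eq)

lemma has_real_derivative_exp_mean:
  "((\<lambda>t. exp_mean t a) has_real_derivative exp (t * a)) (at t)"
  unfolding exp_mean_def
  by (cases "a = 0") (auto intro!: derivative_eq_intros)

lemma coordinate_expansion:
  fixes P :: "real^'n^'n"
  assumes P: "orthogonal_matrix P"
  shows "x = (\<Sum>i\<in>UNIV. (column i P \<bullet> x) *\<^sub>R column i P)"
proof (rule eq_by_coordinates[OF P])
  fix j
  have orth: "column j P \<bullet> column i P = (if i = j then 1 else 0)" for i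
    using P column_unit[OF P, of j] unfolding orthogonal_matrix_orthonormal_columns orthogonal_def
    by auto
  show "column j P \<bullet> x = column j P \<bullet> (\<Sum>i\<in>UNIV. (column i P \<bullet> x) *\<^sub>R column i P)"
    unfolding inner_sum_right inner_scaleR_right orth by (simp add: if_distrib cong: if_cong)
qed

lemma quad_flow_coordinate:
  assumes P: "orthogonal_matrix P"
  shows "column i P \<bullet> quad_flow P a b t x =
    exp_mean t (a $ i) * (column i P \<bullet> b) + exp (t * a $ i) * (column i P \<bullet> x)"
  by (simp add: quad_flow_def inner_add_right eigen_coordinate[OF P])

lemma GDERIV_quad_potential:
  assumes A: "transpose A = A"
  shows "GDERIV (quad_potential A b) x :> A *v x + b"
proof -
  have lin: "((\<lambda>y. A *v y) has_derivative (\<lambda>h. A *v h)) (at x)"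
    by (intro bounded_linear_imp_has_derivative linear_conv_bounded_linear[THEN iffD1]) simp
  have "(quad_potential A b has_derivative (\<lambda>h. (x \<bullet> (A *v h) + h \<bullet> (A *v x)) / 2 + b \<bullet> h)) (at x)"
    unfolding quad_potential_def by (auto intro!: derivative_eq_intros lin)
  moreover have "(x \<bullet> (A *v h) + h \<bullet> (A *v x)) / 2 + b \<bullet> h = h \<bullet> (A *v x + b)" for h
    using symmetric_inner[OF A, of x h] by (simp add: inner_add_right inner_commute)
  ultimately show ?thesis by (simp add: gderiv_def)
qed

lemma GDERIV_unique:
  assumes "GDERIV f x :> v" "GDERIV f x :> w"
  shows "v = w"
proof -
  have "(\<lambda>h. h \<bullet> v) = (\<lambda>h. h \<bullet> w)"
    using assms unfolding gderiv_def by (rule has_derivative_unique)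
  then have "\<forall>h. h \<bullet> v = h \<bullet> w" by (auto dest: fun_cong)
  then show ?thesis using vector_eq_ldot by blast
qed

lemma is_gradient_flow_quad_iff:
  assumes A: "transpose A = A"
  shows "is_gradient_flow (quad_potential A b) \<phi> \<longleftrightarrow> (\<forall>x. \<phi> 0 x = x) \<and>
    (\<forall>x t. ((\<lambda>s. \<phi> s x) has_vector_derivative A *v \<phi> t x + b) (at t))"
  unfolding is_gradient_flow_def
  by (intro conj_cong refl all_cong1) (metis GDERIV_quad_potential[OF A] GDERIV_unique)

lemma is_gradient_flow_quad_flow:
  assumes P: "orthogonal_matrix P"
  shows "is_gradient_flow (quad_potential (conj_diag P a) b) (quad_flow P a b)"
  unfolding is_gradient_flow_quad_iff[OF transpose_conj_diag]
proof (intro conjI allI)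
  fix x
  show "quad_flow P a b 0 x = x"
    by (rule eq_by_coordinates[OF P]) (simp add: quad_flow_coordinate[OF P])
  fix t
  let ?y = "\<lambda>i s. exp_mean s (a $ i) * (column i P \<bullet> b) + exp (s * a $ i) * (column i P \<bullet> x)"
  have der: "(?y i has_real_derivative a $ i * ?y i t + column i P \<bullet> b) (at t)" for i
    unfolding scalar_flow_speed
    by (auto intro!: derivative_eq_intros has_real_derivative_exp_mean simp: algebra_simps)
  have "((\<lambda>s. \<Sum>i\<in>UNIV. ?y i s *\<^sub>R column i P) has_vector_derivative
      (\<Sum>i\<in>UNIV. (a $ i * ?y i t + column i P \<bullet> b) *\<^sub>R column i P)) (at t)"
    using has_vector_derivative_scaleR[OF der has_vector_derivative_const]
    by (intro has_vector_derivative_sum) simp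
  moreover have "(\<lambda>s. \<Sum>i\<in>UNIV. ?y i s *\<^sub>R column i P) = (\<lambda>s. quad_flow P a b s x)"
    using coordinate_expansion[OF P, of "quad_flow P a b _ x"] by (simp add: quad_flow_coordinate[OF P])
  moreover have "(\<Sum>i\<in>UNIV. (a $ i * ?y i t + column i P \<bullet> b) *\<^sub>R column i P)
      = conj_diag P a *v quad_flow P a b t x + b"
    using coordinate_expansion[OF P, of "conj_diag P a *v quad_flow P a b t x + b"]
    by (simp add: inner_add_right eigen_coordinate[OF P] quad_flow_coordinate[OF P])
  ultimately show "((\<lambda>s. quad_flow P a b s x) has_vector_derivative
      conj_diag P a *v quad_flow P a b t x + b) (at t)" by simp
qed

text \<open>In coordinates, the difference of two flows solves \<open>y' = a y\<close> with \<open>y 0 = 0\<close>, so \<open>e\<^sup>-\<^sup>t\<^sup>a y\<close> is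
  constant and equal to zero.\<close>

lemma gradient_flow_quad:
  assumes P: "orthogonal_matrix P"
  shows "gradient_flow (quad_potential (conj_diag P a) b) = quad_flow P a b"
  unfolding gradient_flow_def
proof (rule the_equality)
  show "is_gradient_flow (quad_potential (conj_diag P a) b) (quad_flow P a b)"
    by (rule is_gradient_flow_quad_flow[OF P])
  fix \<phi> assume "is_gradient_flow (quad_potential (conj_diag P a) b) \<phi>"
  then have \<phi>0: "\<phi> 0 x = x"
    and \<phi>: "((\<lambda>s. \<phi> s x) has_vector_derivative conj_diag P a *v \<phi> t x + b) (at t)" for x t
    unfolding is_gradient_flow_quad_iff[OF transpose_conj_diag] by auto
  note flow = is_gradient_flow_quad_flow[OF P, of a b,
      unfolded is_gradient_flow_quad_iff[OF transpose_conj_diag]]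
  show "\<phi> = quad_flow P a b"
  proof (intro ext eq_by_coordinates[OF P])
    fix t x i
    define y where "y s = column i P \<bullet> (\<phi> s x - quad_flow P a b s x)" for s
    have y': "(y has_real_derivative a $ i * y s) (at s)" for s
    proof -
      have "((\<lambda>s. \<phi> s x - quad_flow P a b s x) has_vector_derivative
          (conj_diag P a *v \<phi> s x + b) - (conj_diag P a *v quad_flow P a b s x + b)) (at s)"
        using flow by (intro has_vector_derivative_diff \<phi>) auto
      then have "(y has_vector_derivative column i P \<bullet>
          ((conj_diag P a *v \<phi> s x + b) - (conj_diag P a *v quad_flow P a b s x + b))) (at s)"
        unfolding y_def by (rule bounded_linear.has_vector_derivative[OF bounded_linear_inner_right])
      then show ?thesis
        by (simp add: has_real_derivative_iff_has_vector_derivative y_def inner_diff_right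
            inner_add_right eigen_coordinate[OF P] algebra_simps)
    qed
    have "((\<lambda>s. exp (- (s * a $ i)) * y s) has_real_derivative 0) (at s)" for s
      by (auto intro!: derivative_eq_intros y' simp: algebra_simps)
    then have "exp (- (t * a $ i)) * y t = exp (- (0 * a $ i)) * y 0"
      by (intro DERIV_isconst_all[where f="\<lambda>s. exp (- (s * a $ i)) * y s"]) auto
    then have "y t = 0" using \<phi>0 flow by (simp add: y_def)
    then show "column i P \<bullet> \<phi> t x = column i P \<bullet> quad_flow P a b t x"
      by (simp add: y_def inner_diff_right)
  qed
qed

section \<open>The energy along the flow\<close>

text \<open>\<open>\<integral>\<^sub>0\<^sup>1 s e\<^sup>2\<^sup>s\<^sup>a ds\<close>: the weight with which the squared initial speed enters the loss.\<close>

definition energy_weight :: "real \<Rightarrow> real" where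
  "energy_weight a = (if a = 0 then 1 / 2 else (exp (2 * a) * (2 * a - 1) + 1) / (4 * a\<^sup>2))"

text \<open>Completing the square, \<open>2 a g y = (a y + \<beta>)\<^sup>2 - \<beta>\<^sup>2\<close>, and the velocity \<open>a y + \<beta>\<close> is exponential
  in time; what is left is the integral of \<open>e\<^sup>2\<^sup>a - e\<^sup>2\<^sup>t\<^sup>a\<close>. For \<open>a = 0\<close> the velocity is constant.\<close>

lemma scalar_energy:
  fixes a \<beta> y :: real
  defines "g \<equiv> \<lambda>y. a * y\<^sup>2 / 2 + \<beta> * y" and "Y \<equiv> \<lambda>t. exp_mean t a * \<beta> + exp (t * a) * y"
  shows "has_bochner_integral lborel (\<lambda>t. indicator {0..1} t *\<^sub>R (g (Y 1) - g (Y t)))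
    (energy_weight a * (a * y + \<beta>)\<^sup>2)"
proof (cases "a = 0")
  case True
  have "has_bochner_integral lborel (\<lambda>t. indicator {0..1} t *\<^sub>R (\<beta>\<^sup>2 * (1 - t)))
      (\<beta>\<^sup>2 * (1 - 1\<^sup>2 / 2) - \<beta>\<^sup>2 * (0 - 0\<^sup>2 / 2))"
    by (rule has_bochner_integral_FTC_Icc[where F="\<lambda>t. \<beta>\<^sup>2 * (t - t\<^sup>2 / 2)"])
      (auto intro!: derivative_eq_intros continuous_intros
        simp: has_real_derivative_iff_has_vector_derivative[symmetric] algebra_simps)
  then show ?thesis using True
    by (simp add: g_def Y_def exp_mean_def energy_weight_def power2_eq_square algebra_simps)
next
  case False
  define e where "e = a * y + \<beta>"
  have gg: "g z = ((a * z + \<beta>)\<^sup>2 - \<beta>\<^sup>2) / (2 * a)" for z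
    using False by (simp add: g_def power2_eq_square field_simps)
  have "a * Y t + \<beta> = exp (t * a) * e" for t
    unfolding Y_def e_def by (rule scalar_flow_speed)
  then have diff: "g (Y 1) - g (Y t) = e\<^sup>2 * (exp (2 * a) - exp (2 * t * a)) / (2 * a)" for t
    using False by (simp add: gg power_mult_distrib exp_double[symmetric] diff_divide_distrib[symmetric] algebra_simps)
  define F where "F t = e\<^sup>2 * (t * exp (2 * a) - exp (2 * t * a) / (2 * a)) / (2 * a)" for t
  have "has_bochner_integral lborel (\<lambda>t. indicator {0..1} t *\<^sub>R (g (Y 1) - g (Y t))) (F 1 - F 0)"
    unfolding diff
  proof (rule has_bochner_integral_FTC_Icc)
    fix t :: real
    have "(F has_real_derivative e\<^sup>2 * (exp (2 * a) - exp (2 * t * a)) / (2 * a)) (at t within {0..1})"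
      unfolding F_def using False by (auto intro!: derivative_eq_intros simp: field_simps)
    then show "(F has_vector_derivative e\<^sup>2 * (exp (2 * a) - exp (2 * t * a)) / (2 * a)) (at t within {0..1})"
      by (simp add: has_real_derivative_iff_has_vector_derivative)
  qed (use False in \<open>auto intro!: continuous_intros\<close>)
  moreover have "F 1 - F 0 = energy_weight a * e\<^sup>2"
    using False by (simp add: F_def energy_weight_def field_simps power2_eq_square)
  ultimately show ?thesis by (simp add: e_def)
qed

lemma quad_potential_coordinates:
  assumes P: "orthogonal_matrix P"
  shows "quad_potential (conj_diag P a) b x =
    (\<Sum>i\<in>UNIV. a $ i * (column i P \<bullet> x)\<^sup>2 / 2 + (column i P \<bullet> b) * (column i P \<bullet> x))"
  unfolding quad_potential_def
  by (simp add: inner_conj_diag[OF P] parseval[OF P, of b x] sum.distrib sum_divide_distrib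
      power2_eq_square mult.assoc)

lemma quad_flow_energy:
  fixes P :: "real^'n^'n" and a b :: "real^'n"
  assumes P: "orthogonal_matrix P"
  defines "f \<equiv> quad_potential (conj_diag P a) b"
  shows "(LBINT t:{0..1}. f (quad_flow P a b 1 x) - f (quad_flow P a b t x)) =
    (\<Sum>i\<in>UNIV. energy_weight (a $ i) * (a $ i * (column i P \<bullet> x) + column i P \<bullet> b)\<^sup>2)"
proof -
  let ?g = "\<lambda>i y. a $ i * y\<^sup>2 / 2 + (column i P \<bullet> b) * y"
  let ?Y = "\<lambda>i t. exp_mean t (a $ i) * (column i P \<bullet> b) + exp (t * a $ i) * (column i P \<bullet> x)"
  have "has_bochner_integral lborel
      (\<lambda>t. \<Sum>i\<in>UNIV. indicator {0..1} t *\<^sub>R (?g i (?Y i 1) - ?g i (?Y i t)))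
      (\<Sum>i\<in>UNIV. energy_weight (a $ i) * (a $ i * (column i P \<bullet> x) + column i P \<bullet> b)\<^sup>2)"
    by (intro has_bochner_integral_sum scalar_energy)
  moreover have "(\<Sum>i\<in>UNIV. indicator {0..1} t *\<^sub>R (?g i (?Y i 1) - ?g i (?Y i t)))
      = indicator {0..1} t *\<^sub>R (f (quad_flow P a b 1 x) - f (quad_flow P a b t x))" for t
    unfolding f_def quad_potential_coordinates[OF P] quad_flow_coordinate[OF P]
      sum_subtractf[symmetric] scaleR_sum_right ..
  ultimately show ?thesis
    unfolding set_lebesgue_integral_def by (simp add: has_bochner_integral_iff)
qed

lemma gaussian_quad_flow_energy:
  fixes P :: "real^'n^'n" and a b :: "real^'n"
  assumes P: "orthogonal_matrix P" and S: "S \<in> pos_def_mats"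
  defines "f \<equiv> quad_potential (conj_diag P a) b"
  shows "(\<integral>x. (LBINT t:{0..1}. f (quad_flow P a b 1 x) - f (quad_flow P a b t x)) \<partial>gaussian m S) =
    (\<Sum>i\<in>UNIV. energy_weight (a $ i) *
      ((a $ i * (column i P \<bullet> m) + column i P \<bullet> b)\<^sup>2 + (a $ i)\<^sup>2 * (column i P \<bullet> (S *v column i P))))"
proof -
  have "has_bochner_integral (gaussian m S)
      (\<lambda>x. (a $ i * (column i P \<bullet> x) + column i P \<bullet> b)\<^sup>2)
      ((a $ i * (column i P \<bullet> m) + column i P \<bullet> b)\<^sup>2 + (a $ i)\<^sup>2 * (column i P \<bullet> (S *v column i P)))" for i
    using gaussian_square[OF S, of m "a $ i * (column i P \<bullet> m) + column i P \<bullet> b" "a $ i *\<^sub>R column i P"]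
    by (simp add: inner_diff_right right_diff_distrib matrix_vector_mult_scaleR power2_eq_square mult.assoc
        add.commute)
  then have "has_bochner_integral (gaussian m S)
      (\<lambda>x. \<Sum>i\<in>UNIV. energy_weight (a $ i) * (a $ i * (column i P \<bullet> x) + column i P \<bullet> b)\<^sup>2)
      (\<Sum>i\<in>UNIV. energy_weight (a $ i) *
      ((a $ i * (column i P \<bullet> m) + column i P \<bullet> b)\<^sup>2 + (a $ i)\<^sup>2 * (column i P \<bullet> (S *v column i P))))"
    by (intro has_bochner_integral_sum has_bochner_integral_mult_right)
  then show ?thesis
    unfolding f_def quad_flow_energy[OF P] by (rule has_bochner_integral_integral_eq)
qed

section \<open>The transport potential\<close>

lemma quad_flow_gaussian:
  fixes P :: "real^'n^'n" and a b :: "real^'n"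
  assumes P: "orthogonal_matrix P" and S: "S \<in> pos_def_mats"
  defines "R \<equiv> conj_diag P (\<chi> i. exp (a $ i))"
  shows "distr (gaussian m S) borel (quad_flow P a b 1) =
    gaussian (conj_diag P (\<chi> i. exp_mean 1 (a $ i)) *v b + R *v m) (R ** S ** R)"
  using gaussian_affine_image[OF S P, of "\<chi> i. exp (a $ i)" m "conj_diag P (\<chi> i. exp_mean 1 (a $ i)) *v b"]
  by (simp add: R_def quad_flow_def[abs_def])

lemma pos_def_congruence:
  assumes R: "R \<in> pos_def_mats" and S: "S \<in> pos_def_mats"
  shows "R ** S ** R \<in> pos_def_mats"
proof -
  have tR: "transpose R = R" using R by (simp add: pos_def_mats_def)
  have "x \<bullet> (R ** S ** R *v x) > 0" if "x \<noteq> 0" for x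
  proof -
    have "x \<bullet> (R *v x) > 0" using R that by (simp add: pos_def_mats_def)
    then have "R *v x \<noteq> 0" by auto
    then have "(R *v x) \<bullet> (S *v (R *v x)) > 0" using S by (simp add: pos_def_mats_def)
    then show ?thesis by (simp add: matrix_vector_mul_assoc[symmetric] symmetric_inner[OF tR])
  qed
  then show ?thesis
    using S tR by (simp add: pos_def_mats_def matrix_transpose_mul matrix_mul_assoc)
qed

text \<open>For any competing potential with matrix \<open>A'\<close>, comparing covariances shows that \<open>exp A'\<close> is a
  positive definite solution of the transport equation, so \<open>exp A'\<close> is the transport matrix. Comparing
  means then fixes the linear part, because the matrix that averages \<open>exp (s A')\<close> over \<open>s\<close> is
  invertible.\<close>

lemma wkl_potential_eq:
  fixes P :: "real^'n^'n" and r m0 m1 :: "real^'n"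
  assumes S0: "S0 \<in> pos_def_mats" and S1: "S1 \<in> pos_def_mats"
    and P: "orthogonal_matrix P" and r: "transport_mat S0 S1 = conj_diag P r" "\<And>i. 0 < r $ i"
  defines "a \<equiv> \<chi> i. ln (r $ i)"
  defines "b \<equiv> conj_diag P (\<chi> i. inverse (exp_mean 1 (a $ i))) *v (m1 - conj_diag P r *v m0)"
  shows "wkl_potential (gaussian m0 S0) (gaussian m1 S1) = quad_potential (conj_diag P a) b"
  unfolding wkl_potential_def
proof (rule the_equality)
  have ra: "(\<chi> i. exp (a $ i)) = r" using r(2) by (simp add: a_def vec_eq_iff)
  have k0: "exp_mean 1 (a $ i) \<noteq> 0" for i using exp_mean_1_pos[of "a $ i"] by simp
  have eq: "conj_diag P r ** S0 ** conj_diag P r = S1"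
    using transport_mat_spec(2)[OF S0 pos_def_imp_semidef[OF S1]] r(1) by simp
  have b: "conj_diag P (\<chi> i. exp_mean 1 (a $ i)) *v b + conj_diag P r *v m0 = m1"
    unfolding b_def by (simp add: matrix_vector_mul_assoc conj_diag_mult[OF P] k0 conj_diag_one[OF P])
  show "quadratic_potential (quad_potential (conj_diag P a) b) \<and>
    distr (gaussian m0 S0) borel (gradient_flow (quad_potential (conj_diag P a) b) 1) = gaussian m1 S1"
    unfolding gradient_flow_quad[OF P] quad_flow_gaussian[OF P S0] ra eq b
    unfolding quadratic_potential_def quad_potential_def using transpose_conj_diag by blast
  fix f assume f: "quadratic_potential f \<and> distr (gaussian m0 S0) borel (gradient_flow f 1) = gaussian m1 S1"
  then obtain A' b' where A': "transpose A' = A'" and fA: "f = quad_potential A' b'"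
    unfolding quadratic_potential_def quad_potential_def by blast
  obtain Q a' where Q: "orthogonal_matrix Q" and A'Q: "A' = conj_diag Q a'"
    using A' by (rule spectral_theorem)
  let ?R = "conj_diag Q (\<chi> i. exp (a' $ i))"
  let ?K = "conj_diag Q (\<chi> i. exp_mean 1 (a' $ i))"
  have Rpd: "?R \<in> pos_def_mats" by (simp add: conj_diag_pos_def_iff[OF Q])
  have "gaussian (?K *v b' + ?R *v m0) (?R ** S0 ** ?R) = gaussian m1 S1"
    using f unfolding fA A'Q gradient_flow_quad[OF Q] quad_flow_gaussian[OF Q S0] by simp
  note inj = gaussian_inject[OF pos_def_congruence[OF Rpd S0] S1 this]
  have "transport_mat S0 S1 = ?R"
    using transport_mat_unique[OF S0 pos_def_imp_semidef[OF Rpd]] inj(2) by simp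
  then have Rr: "?R = conj_diag P r" using r by simp
  have "conj_diag Q (\<chi> i. ln ((\<chi> i. exp (a' $ i)) $ i)) = conj_diag P (\<chi> i. ln (r $ i))"
    by (rule conj_diag_apply_cong[OF Q P Rr])
  then have aa: "conj_diag Q a' = conj_diag P a" by (simp add: a_def)
  then have "?K = conj_diag P (\<chi> i. exp_mean 1 (a $ i))"
    by (rule conj_diag_apply_cong[OF Q P])
  then have "conj_diag P (\<chi> i. exp_mean 1 (a $ i)) *v b' = m1 - conj_diag P r *v m0"
    using inj(1) Rr by (simp add: algebra_simps)
  then have "b = conj_diag P (\<chi> i. inverse (exp_mean 1 (a $ i))) *v
      (conj_diag P (\<chi> i. exp_mean 1 (a $ i)) *v b')"
    by (simp add: b_def)
  also have "\<dots> = b'"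
    by (simp add: matrix_vector_mul_assoc conj_diag_mult[OF P] k0 conj_diag_one[OF P])
  finally show "f = quad_potential (conj_diag P a) b"
    by (simp add: fA A'Q aa)
qed

section \<open>Closed form of the loss\<close>

lemma energy_weight_psi:
  assumes "0 < r"
  shows "energy_weight (ln r) * (ln r)\<^sup>2 = psi_profile r / 4"
proof (cases "r = 1")
  case False
  have "exp (2 * ln r) = r\<^sup>2" using assms by (simp add: exp_double)
  moreover have "ln (r\<^sup>2) = 2 * ln r" using assms by (simp add: ln_realpow)
  ultimately show ?thesis
    using assms False by (simp add: energy_weight_def psi_profile_def chi_profile_def field_simps)
qed (simp add: psi_profile_def chi_profile_def)

lemma energy_weight_kappa:
  assumes "0 < r"
  shows "energy_weight (ln r) / (exp_mean 1 (ln r))\<^sup>2 = kappa_profile r / 4"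
proof (cases "r = 1")
  case True
  then show ?thesis by (simp add: energy_weight_def exp_mean_def kappa_profile_def)
next
  case False
  have "exp_mean 1 (ln r) = (r - 1) / ln r" using assms False by (simp add: exp_mean_def)
  then have "energy_weight (ln r) / (exp_mean 1 (ln r))\<^sup>2 = energy_weight (ln r) * (ln r)\<^sup>2 / (r - 1)\<^sup>2"
    using assms False by (simp add: power_divide)
  then show ?thesis
    using assms False by (simp add: energy_weight_psi kappa_profile_alt)
qed

text \<open>The linear part of the potential is chosen so that the initial velocity at \<open>m0\<close> has the coordinates
  of \<open>m1 - m0\<close> divided by \<open>exp_mean 1 a\<close>; around this mean the velocity has variance
  \<open>a\<^sup>2 (u \<bullet> S0 u)\<close>. The energy weight turns these two contributions into \<open>\<kappa>\<close> and \<open>\<psi>\<close>.\<close>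

lemma wkl_loss_eigen:
  fixes P :: "real^'n^'n"
  assumes S0: "S0 \<in> pos_def_mats" and S1: "S1 \<in> pos_def_mats"
    and P: "orthogonal_matrix P" and r: "transport_mat S0 S1 = conj_diag P r"
  shows "wkl_loss (m0, S0, m1, S1) = (\<Sum>i\<in>UNIV. psi_profile (r $ i) * (column i P \<bullet> (S0 *v column i P))
      + kappa_profile (r $ i) * (column i P \<bullet> (m1 - m0))\<^sup>2) / 4"
proof -
  have r0: "0 < r $ i" for i
    using transport_mat_pos_def[OF S0 S1] by (simp add: r conj_diag_pos_def_iff[OF P])
  define a where "a = (\<chi> i. ln (r $ i))"
  define b where "b = conj_diag P (\<chi> i. inverse (exp_mean 1 (a $ i))) *v (m1 - conj_diag P r *v m0)"
  have pot: "wkl_potential (gaussian m0 S0) (gaussian m1 S1) = quad_potential (conj_diag P a) b"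
    unfolding a_def b_def by (rule wkl_potential_eq[OF S0 S1 P r r0])
  have summand: "energy_weight (a $ i) * ((a $ i * (column i P \<bullet> m0) + column i P \<bullet> b)\<^sup>2
        + (a $ i)\<^sup>2 * (column i P \<bullet> (S0 *v column i P)))
      = (psi_profile (r $ i) * (column i P \<bullet> (S0 *v column i P))
        + kappa_profile (r $ i) * (column i P \<bullet> (m1 - m0))\<^sup>2) / 4" for i
  proof -
    define k where "k = exp_mean 1 (a $ i)"
    have k: "0 < k" "a $ i * k = r $ i - 1"
      using r0[of i] exp_mean_eq[of "a $ i" 1] by (auto simp: k_def exp_mean_1_pos a_def)
    have "column i P \<bullet> b = inverse k * (column i P \<bullet> m1 - r $ i * (column i P \<bullet> m0))"
      by (simp add: b_def eigen_coordinate[OF P] inner_diff_right k_def)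
    then have kb: "k * (column i P \<bullet> b) = column i P \<bullet> m1 - r $ i * (column i P \<bullet> m0)"
      using k(1) by (simp add: mult.assoc[symmetric])
    have "k * (a $ i * (column i P \<bullet> m0) + column i P \<bullet> b)
        = (a $ i * k) * (column i P \<bullet> m0) + (column i P \<bullet> m1 - r $ i * (column i P \<bullet> m0))"
      unfolding kb[symmetric] by (simp add: algebra_simps)
    also have "\<dots> = column i P \<bullet> (m1 - m0)"
      unfolding k(2) by (simp add: inner_diff_right algebra_simps)
    finally have "a $ i * (column i P \<bullet> m0) + column i P \<bullet> b = column i P \<bullet> (m1 - m0) / k"
      using k(1) by (simp add: field_simps)
    then have "energy_weight (a $ i) * ((a $ i * (column i P \<bullet> m0) + column i P \<bullet> b)\<^sup>2
        + (a $ i)\<^sup>2 * (column i P \<bullet> (S0 *v column i P)))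
      = (energy_weight (a $ i) / k\<^sup>2) * (column i P \<bullet> (m1 - m0))\<^sup>2
        + (energy_weight (a $ i) * (a $ i)\<^sup>2) * (column i P \<bullet> (S0 *v column i P))"
      by (simp add: power_divide algebra_simps)
    also have "\<dots> = (kappa_profile (r $ i) / 4) * (column i P \<bullet> (m1 - m0))\<^sup>2
        + (psi_profile (r $ i) / 4) * (column i P \<bullet> (S0 *v column i P))"
      by (simp only: k_def a_def vec_lambda_beta energy_weight_psi[OF r0] energy_weight_kappa[OF r0])
    finally show ?thesis by (simp add: algebra_simps)
  qed
  have "wkl_loss (m0, S0, m1, S1) = (\<Sum>i\<in>UNIV. energy_weight (a $ i) *
      ((a $ i * (column i P \<bullet> m0) + column i P \<bullet> b)\<^sup>2 + (a $ i)\<^sup>2 * (column i P \<bullet> (S0 *v column i P))))"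
    by (simp add: wkl_loss_def D_WKL_def Let_def pot gradient_flow_quad[OF P]
        gaussian_quad_flow_energy[OF P S0])
  then show ?thesis unfolding summand by (simp add: sum_divide_distrib)
qed

section \<open>The trace formula\<close>

text \<open>Unlike the loss itself, this expression stays meaningful for a singular second covariance.\<close>

definition wkl_formula :: "'n::finite gauss_pair \<Rightarrow> real" where
  "wkl_formula = (\<lambda>(m0, S0, m1, S1). let R = transport_mat S0 S1 in
     trace (S0 - S1 + S0 ** spectral_fun chi_profile R) / 4
     + ((m1 - m0) \<bullet> (spectral_fun kappa_profile R *v (m1 - m0))) / 4)"

text \<open>The trace of \<open>S1\<close>, computed in the eigenbasis, supplies the summand \<open>- r\<^sup>2\<close> of \<open>\<psi>\<close>.\<close>

lemma wkl_formula_eigen: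
  fixes P :: "real^'n^'n"
  assumes S0: "S0 \<in> pos_def_mats" and S1: "S1 \<in> pos_semidef_mats"
    and P: "orthogonal_matrix P" and r: "transport_mat S0 S1 = conj_diag P r"
  shows "wkl_formula (m0, S0, m1, S1) = (\<Sum>i\<in>UNIV. psi_profile (r $ i) * (column i P \<bullet> (S0 *v column i P))
      + kappa_profile (r $ i) * (column i P \<bullet> (m1 - m0))\<^sup>2) / 4"
proof -
  let ?q = "\<lambda>i. column i P \<bullet> (S0 *v column i P)"
  have eq: "conj_diag P r ** S0 ** conj_diag P r = S1"
    using transport_mat_spec(2)[OF S0 S1] r by simp
  have "trace (S0 - S1 + S0 ** spectral_fun chi_profile (conj_diag P r))
      = (\<Sum>i\<in>UNIV. ?q i) - (\<Sum>i\<in>UNIV. (r $ i)\<^sup>2 * ?q i) + (\<Sum>i\<in>UNIV. chi_profile (r $ i) * ?q i)"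
    unfolding trace_add trace_sub spectral_fun_conj_diag[OF P] trace_mult_conj_diag[OF P]
      trace_eq_sum_quadratic[OF P, of S0] trace_eq_sum_quadratic[OF P, of S1]
      transport_eigen_quadratic[OF P eq] vec_lambda_beta ..
  also have "\<dots> = (\<Sum>i\<in>UNIV. psi_profile (r $ i) * ?q i)"
    by (simp add: sum_subtractf[symmetric] sum.distrib[symmetric] psi_profile_def algebra_simps)
  finally show ?thesis
    by (simp add: wkl_formula_def Let_def r spectral_fun_conj_diag[OF P] inner_conj_diag[OF P]
        sum.distrib add_divide_distrib power2_eq_square mult.assoc)
qed

lemma wkl_formula_eq_loss:
  assumes "p \<in> regular_pairs"
  shows "wkl_formula p = wkl_loss p"
proof -
  obtain m0 S0 m1 S1 where p: "p = (m0, S0, m1, S1)" "S0 \<in> pos_def_mats" "S1 \<in> pos_def_mats"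
    using assms by (auto simp: regular_pairs_def)
  note S1 = pos_def_imp_semidef[OF p(3)]
  obtain P r where P: "orthogonal_matrix P" and r: "transport_mat S0 S1 = conj_diag P r"
    using transport_mat_spec(1)[OF p(2) S1] by (rule spectral_theorem_pos_semidef) blast
  show ?thesis
    unfolding p(1) wkl_formula_eigen[OF p(2) S1 P r] wkl_loss_eigen[OF p(2,3) P r] ..
qed

text \<open>The covariance part is nonnegative because \<open>\<psi> \<ge> 0\<close>; as \<open>\<kappa> \<ge> 1\<close>, the mean part dominates the
  squared norm.\<close>

lemma wkl_formula_ge:
  assumes S0: "S0 \<in> pos_def_mats" and S1: "S1 \<in> pos_semidef_mats"
  shows "(norm (m1 - m0))\<^sup>2 / 4 \<le> wkl_formula (m0, S0, m1, S1)"
proof -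
  obtain P r where P: "orthogonal_matrix P" and r: "transport_mat S0 S1 = conj_diag P r" "\<And>i. 0 \<le> r $ i"
    using transport_mat_spec(1)[OF S0 S1] by (rule spectral_theorem_pos_semidef) blast
  have "(norm (m1 - m0))\<^sup>2 = (\<Sum>i\<in>UNIV. (column i P \<bullet> (m1 - m0))\<^sup>2)"
    unfolding power2_norm_eq_inner parseval[OF P, of "m1 - m0" "m1 - m0"] by (simp add: power2_eq_square)
  also have "\<dots> \<le> (\<Sum>i\<in>UNIV. psi_profile (r $ i) * (column i P \<bullet> (S0 *v column i P))
      + kappa_profile (r $ i) * (column i P \<bullet> (m1 - m0))\<^sup>2)"
  proof (rule sum_mono)
    fix i
    have "0 \<le> psi_profile (r $ i) * (column i P \<bullet> (S0 *v column i P))"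
      using pos_def_imp_semidef[OF S0] psi_profile_nonneg[OF r(2)]
      by (intro mult_nonneg_nonneg) (auto simp: pos_semidef_mats_def)
    moreover have "1 * (column i P \<bullet> (m1 - m0))\<^sup>2 \<le> kappa_profile (r $ i) * (column i P \<bullet> (m1 - m0))\<^sup>2"
      by (intro mult_right_mono kappa_profile_ge_1 r) simp
    ultimately show "(column i P \<bullet> (m1 - m0))\<^sup>2 \<le> psi_profile (r $ i) * (column i P \<bullet> (S0 *v column i P))
      + kappa_profile (r $ i) * (column i P \<bullet> (m1 - m0))\<^sup>2" by linarith
  qed
  finally show ?thesis unfolding wkl_formula_eigen[OF S0 S1 P r(1)] by simp
qed

lemma continuous_on_wkl_formula:
  "continuous_on (UNIV \<times> pos_def_mats \<times> UNIV \<times> pos_semidef_mats) (wkl_formula :: 'n::finite gauss_pair \<Rightarrow> real)"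
proof -
  let ?V = "UNIV \<times> pos_def_mats \<times> UNIV \<times> pos_semidef_mats :: 'n gauss_pair set"
  let ?R = "\<lambda>p :: 'n gauss_pair. transport_mat (fst (snd p)) (snd (snd (snd p)))"
  have R: "continuous_on ?V ?R"
  proof -
    have "continuous_on ?V (\<lambda>p. (fst (snd p), snd (snd (snd p))))" by (intro continuous_intros)
    moreover have "(\<lambda>p. (fst (snd p), snd (snd (snd p)))) ` ?V \<subseteq> pos_def_mats \<times> pos_semidef_mats"
      by auto
    ultimately show ?thesis
      using continuous_on_compose2[OF continuous_on_transport_mat] by fastforce
  qed
  have h: "continuous_on ?V (\<lambda>p. spectral_fun h (?R p))" if "continuous_on {0..} h" for h
  proof (rule continuous_on_compose2[OF _ R])
    show "continuous_on pos_semidef_mats (spectral_fun h :: real^'n^'n \<Rightarrow> _)"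
      unfolding pos_semidef_mats_spectrum by (rule continuous_on_spectral_fun[OF that])
    show "?R ` ?V \<subseteq> pos_semidef_mats" using transport_mat_spec(1) by auto
  qed
  show ?thesis
    unfolding wkl_formula_def Let_def case_prod_unfold
    by (intro continuous_intros h continuous_on_chi_profile continuous_on_kappa_profile) simp_all
qed

section \<open>Blow-up at singular initial covariance\<close>

text \<open>Cauchy-Schwarz in each row.\<close>

lemma norm_matrix_vector_mult_le:
  fixes A :: "real^'n^'m"
  shows "norm (A *v x) \<le> norm A * norm x"
proof -
  have "norm (A *v x) = L2_set (\<lambda>i. norm (A $ i \<bullet> x)) UNIV"
    by (simp add: norm_vec_def matrix_vector_mult_def inner_vec_def)
  also have "\<dots> \<le> L2_set (\<lambda>i. norm (A $ i) * norm x) UNIV"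
    by (intro L2_set_mono) (simp_all add: Cauchy_Schwarz_ineq2)
  also have "\<dots> = norm A * norm x"
    by (simp add: norm_vec_def[of A] L2_set_left_distrib)
  finally show ?thesis .
qed

text \<open>Half the smallest eigenvalue of \<open>S\<close> serves both as the radius and as the lower bound: a perturbation
  of norm less than \<open>c\<close> changes the quadratic form by at most \<open>c (x \<bullet> x)\<close>.\<close>

lemma pos_def_locally_bounded_below:
  fixes S :: "real^'n^'n"
  assumes "S \<in> pos_def_mats"
  obtains c where "0 < c" "\<And>T x. dist T S < c \<Longrightarrow> c * (x \<bullet> x) \<le> x \<bullet> (T *v x)"
proof -
  obtain P d where P: "orthogonal_matrix P" and S: "S = conj_diag P d" and d: "\<And>i. 0 < d $ i"
    using assms by (rule spectral_theorem_pos_def) blast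
  define c where "c = Min (range (($) d)) / 2"
  have c: "0 < c" "\<And>i. 2 * c \<le> d $ i" using d by (auto simp: c_def)
  have S_ge: "2 * c * (x \<bullet> x) \<le> x \<bullet> (S *v x)" for x
    unfolding S inner_conj_diag[OF P] parseval[OF P, of x x] sum_distrib_left mult.assoc[symmetric]
  proof (rule sum_mono)
    fix i
    show "2 * c * (column i P \<bullet> x) * (column i P \<bullet> x) \<le> d $ i * (column i P \<bullet> x) * (column i P \<bullet> x)"
      using mult_right_mono[OF c(2)[of i], of "(column i P \<bullet> x)\<^sup>2"]
      by (simp add: power2_eq_square mult.assoc)
  qed
  have "c * (x \<bullet> x) \<le> x \<bullet> (T *v x)" if T: "dist T S < c" for T x
  proof -
    have "x \<bullet> (S *v x) - x \<bullet> (T *v x) = x \<bullet> ((S - T) *v x)"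
      by (simp add: matrix_vector_mult_diff_rdistrib inner_diff_right)
    also have "\<dots> \<le> norm x * norm ((S - T) *v x)" by (rule norm_cauchy_schwarz)
    also have "\<dots> \<le> norm x * (norm (S - T) * norm x)"
      by (intro mult_left_mono norm_matrix_vector_mult_le) simp
    also have "\<dots> = norm (S - T) * (x \<bullet> x)" by (simp add: power2_norm_eq_inner[symmetric] power2_eq_square)
    also have "\<dots> \<le> c * (x \<bullet> x)"
      using T by (intro mult_right_mono) (auto simp: dist_norm norm_minus_commute)
    finally show ?thesis using S_ge[of x] by simp
  qed
  with c(1) show ?thesis using that by blast
qed

lemma pos_def_relatively_open:
  fixes S :: "real^'n^'n"
  assumes "S \<in> pos_def_mats"
  obtains e where "0 < e" "\<And>T. dist T S < e \<Longrightarrow> T \<in> pos_semidef_mats \<Longrightarrow> T \<in> pos_def_mats"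
proof -
  obtain c where c: "0 < c" "\<And>T x. dist T S < c \<Longrightarrow> c * (x \<bullet> x) \<le> x \<bullet> (T *v x)"
    using assms by (rule pos_def_locally_bounded_below) blast
  have "T \<in> pos_def_mats" if "dist T S < c" "T \<in> pos_semidef_mats" for T
  proof -
    have "0 < x \<bullet> (T *v x)" if "x \<noteq> 0" for x
      using c(2)[OF \<open>dist T S < c\<close>, of x] c(1) that
      by (meson inner_gt_zero_iff less_le_trans mult_pos_pos)
    then show ?thesis using that(2) by (simp add: pos_def_mats_def pos_semidef_mats_def)
  qed
  with c(1) show ?thesis using that by blast
qed

text \<open>If \<open>S0\<close> is nearly degenerate in the direction \<open>v\<close>, then \<open>R\<close> has a large eigenvalue: for \<open>v = R w\<close>,
  on the one hand \<open>v \<bullet> S0 v = w \<bullet> S1 w \<ge> c (w \<bullet> w)\<close>, on the other hand \<open>1 = v \<bullet> v \<le> r\<^sup>2 (w \<bullet> w)\<close> for the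
  largest eigenvalue \<open>r\<close>. An eigenvector \<open>u\<close> of \<open>r\<close> alone contributes
  \<open>\<psi> r (u \<bullet> S0 u) = (\<psi> r / r\<^sup>2) (u \<bullet> S1 u) \<ge> c (ln r\<^sup>2 - 1)\<close> to four times the loss.\<close>

lemma wkl_formula_blow_up:
  fixes v :: "real^'n"
  assumes S0: "S0 \<in> pos_def_mats" and S1: "S1 \<in> pos_def_mats"
    and c: "0 < c" "\<And>x. c * (x \<bullet> x) \<le> x \<bullet> (S1 *v x)" and v: "norm v = 1"
  shows "c * (ln (c / (v \<bullet> (S0 *v v))) - 1) / 4 \<le> wkl_formula (m0, S0, m1, S1)"
proof -
  have S1': "S1 \<in> pos_semidef_mats" by (rule pos_def_imp_semidef[OF S1])
  obtain P r where P: "orthogonal_matrix P" and r: "transport_mat S0 S1 = conj_diag P r" "\<And>i. 0 < r $ i"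
    using transport_mat_pos_def[OF S0 S1] by (rule spectral_theorem_pos_def) blast
  have r0: "r $ i \<noteq> 0" for i using r(2)[of i] by simp
  have eq: "conj_diag P r ** S0 ** conj_diag P r = S1"
    using transport_mat_spec(2)[OF S0 S1'] r by simp
  define w where "w = conj_diag P (\<chi> i. inverse (r $ i)) *v v"
  have Rw: "conj_diag P r *v w = v"
    by (simp add: w_def matrix_vector_mul_assoc conj_diag_mult[OF P] r0 conj_diag_one[OF P])
  have "Max (range (($) r)) \<in> range (($) r)" by (rule Max_in) auto
  then obtain k where k: "Max (range (($) r)) = r $ k" by (rule imageE)
  have rk: "r $ i \<le> r $ k" for i unfolding k[symmetric] by (rule Max_ge) auto
  have "v \<noteq> 0" using v by auto
  then have v0: "0 < v \<bullet> (S0 *v v)" using S0 by (simp add: pos_def_mats_def)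
  have "c * 1 = c * (\<Sum>i\<in>UNIV. (r $ i)\<^sup>2 * (column i P \<bullet> w)\<^sup>2)"
  proof -
    have "1 = v \<bullet> v" using v by (simp add: dot_square_norm)
    also have "\<dots> = (\<Sum>i\<in>UNIV. (r $ i)\<^sup>2 * (column i P \<bullet> w)\<^sup>2)"
      unfolding parseval[OF P, of v v] unfolding Rw[symmetric] eigen_coordinate[OF P]
      by (simp add: power2_eq_square mult_ac)
    finally show ?thesis by simp
  qed
  also have "\<dots> \<le> c * ((r $ k)\<^sup>2 * (w \<bullet> w))"
  proof -
    have "(\<Sum>i\<in>UNIV. (r $ i)\<^sup>2 * (column i P \<bullet> w)\<^sup>2) \<le> (\<Sum>i\<in>UNIV. (r $ k)\<^sup>2 * (column i P \<bullet> w)\<^sup>2)"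
      by (intro sum_mono mult_right_mono power_mono rk less_imp_le[OF r(2)]) simp
    also have "\<dots> = (r $ k)\<^sup>2 * (w \<bullet> w)"
      by (simp add: parseval[OF P, of w w] sum_distrib_left power2_eq_square)
    finally show ?thesis using c(1) by simp
  qed
  also have "\<dots> = (r $ k)\<^sup>2 * (c * (w \<bullet> w))" by simp
  also have "\<dots> \<le> (r $ k)\<^sup>2 * (w \<bullet> (S1 *v w))" by (intro mult_left_mono c) simp
  also have "w \<bullet> (S1 *v w) = v \<bullet> (S0 *v v)"
    unfolding eq[symmetric] matrix_vector_mul_assoc[symmetric] Rw
    by (simp add: symmetric_inner[OF transpose_conj_diag, symmetric] Rw)
  finally have rk_ge: "c / (v \<bullet> (S0 *v v)) \<le> (r $ k)\<^sup>2" using v0 by (simp add: divide_le_eq)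
  let ?q = "\<lambda>i. column i P \<bullet> (S0 *v column i P)"
  have nonneg: "0 \<le> psi_profile (r $ i) * ?q i" for i
    using pos_def_imp_semidef[OF S0] psi_profile_nonneg[OF less_imp_le[OF r(2)]]
    by (intro mult_nonneg_nonneg) (auto simp: pos_semidef_mats_def)
  have "c * (ln (c / (v \<bullet> (S0 *v v))) - 1) \<le> c * (ln ((r $ k)\<^sup>2) - 1)"
    using rk_ge c(1) v0 r0[of k] by (intro mult_left_mono diff_right_mono) (auto intro!: ln_mono)
  also have "\<dots> \<le> c * (psi_profile (r $ k) / (r $ k)\<^sup>2)"
    using c(1) r0[of k] by (intro mult_left_mono) (auto simp: psi_profile_def chi_profile_def field_simps)
  also have "\<dots> = psi_profile (r $ k) / (r $ k)\<^sup>2 * (c * (column k P \<bullet> column k P))"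
    by (simp add: column_unit[OF P])
  also have "\<dots> \<le> psi_profile (r $ k) / (r $ k)\<^sup>2 * (column k P \<bullet> (S1 *v column k P))"
    using psi_profile_nonneg[of "r $ k"] r(2)[of k] by (intro mult_left_mono c(2)) auto
  also have "\<dots> = psi_profile (r $ k) * ?q k"
    using r0[of k] by (simp add: transport_eigen_quadratic[OF P eq])
  also have "\<dots> \<le> (\<Sum>i\<in>UNIV. psi_profile (r $ i) * ?q i)"
    using member_le_sum[of k UNIV "\<lambda>i. psi_profile (r $ i) * ?q i"] nonneg by simp
  also have "\<dots> \<le> (\<Sum>i\<in>UNIV. psi_profile (r $ i) * ?q i + kappa_profile (r $ i) * (column i P \<bullet> (m1 - m0))\<^sup>2)"
    using kappa_profile_ge_1[OF less_imp_le[OF r(2)]] by (intro sum_mono) (simp add: order_trans[OF zero_le_one])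
  finally show ?thesis unfolding wkl_formula_eigen[OF S0 S1' P r(1)] by simp
qed

section \<open>The extension to one singular covariance\<close>

definition wkl_extension :: "'n::finite gauss_pair \<Rightarrow> ereal" where
  "wkl_extension p = (if fst (snd p) \<in> pos_def_mats then ereal (wkl_formula p) else \<infinity>)"

lemma semidef_not_def_kernel:
  assumes "S \<in> pos_semidef_mats" "S \<notin> pos_def_mats"
  obtains v where "norm v = 1" "v \<bullet> (S *v v) = 0"
proof -
  obtain P d where P: "orthogonal_matrix P" and S: "S = conj_diag P d" and d: "\<And>i. 0 \<le> d $ i"
    using assms(1) by (rule spectral_theorem_pos_semidef) blast
  obtain i where "\<not> 0 < d $ i" using assms(2) unfolding S conj_diag_pos_def_iff[OF P] by auto
  then have "d $ i = 0" using d[of i] by simp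
  then show ?thesis
    using that[of "column i P"] column_unit[OF P, of i]
    by (simp add: S eigenvector_column[OF P] norm_eq_1)
qed

lemma tendsto_covariances:
  fixes p :: "'n::finite gauss_pair"
  shows "((\<lambda>q. fst (snd q)) \<longlongrightarrow> fst (snd p)) (at p within X)"
    "((\<lambda>q. snd (snd (snd q))) \<longlongrightarrow> snd (snd (snd p))) (at p within X)"
  by (intro tendsto_fst tendsto_snd tendsto_ident_at)+

lemma eventually_in_set: "\<forall>\<^sub>F q in at p within X. q \<in> X"
  by (simp add: eventually_at_filter)

lemma eventually_first_pos_def:
  fixes p :: "'n::finite gauss_pair"
  assumes "fst (snd p) \<in> pos_def_mats" "X \<subseteq> all_pairs"
  shows "\<forall>\<^sub>F q in at p within X. fst (snd q) \<in> pos_def_mats"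
proof -
  obtain e where e: "0 < e" "\<And>T. dist T (fst (snd p)) < e \<Longrightarrow> T \<in> pos_semidef_mats \<Longrightarrow> T \<in> pos_def_mats"
    using assms(1) by (rule pos_def_relatively_open) blast
  from tendstoD[OF tendsto_covariances(1) e(1)] eventually_in_set
  show ?thesis
  proof eventually_elim
    case (elim q)
    then have "fst (snd q) \<in> pos_semidef_mats" using assms(2) by (auto simp: all_pairs_def)
    then show ?case using elim e(2) by blast
  qed
qed

lemma eventually_second_pos_def:
  fixes p :: "'n::finite gauss_pair"
  assumes "snd (snd (snd p)) \<in> pos_def_mats" "X \<subseteq> all_pairs"
  shows "\<forall>\<^sub>F q in at p within X. snd (snd (snd q)) \<in> pos_def_mats"
proof -
  obtain e where e: "0 < e" "\<And>T. dist T (snd (snd (snd p))) < e \<Longrightarrow> T \<in> pos_semidef_mats \<Longrightarrow> T \<in> pos_def_mats"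
    using assms(1) by (rule pos_def_relatively_open) blast
  from tendstoD[OF tendsto_covariances(2) e(1)] eventually_in_set
  show ?thesis
  proof eventually_elim
    case (elim q)
    then have "snd (snd (snd q)) \<in> pos_semidef_mats" using assms(2) by (auto simp: all_pairs_def)
    then show ?case using elim e(2) by blast
  qed
qed

lemma half_regular_subset_all: "half_regular_pairs \<subseteq> all_pairs"
  by (auto simp: half_regular_pairs_def all_pairs_def intro: pos_def_imp_semidef)

lemma half_regular_iff:
  "p \<in> half_regular_pairs \<longleftrightarrow> p \<in> all_pairs \<and> (fst (snd p) \<in> pos_def_mats \<or> snd (snd (snd p)) \<in> pos_def_mats)"
  by (cases p) (auto simp: half_regular_pairs_def all_pairs_def intro: pos_def_imp_semidef)

text \<open>At a positive definite \<open>S0\<close> this is the continuity of the trace formula, as positive definite matrices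
  are relatively open among the positive semidefinite ones. At a singular \<open>S0\<close>, nearby second
  covariances are uniformly positive definite, while the quadratic form of the first covariance tends
  to zero on a kernel vector of \<open>S0\<close>.\<close>

lemma continuous_on_wkl_extension:
  "continuous_on half_regular_pairs (wkl_extension :: 'n::finite gauss_pair \<Rightarrow> ereal)"
  unfolding continuous_on_def
proof
  fix p :: "'n gauss_pair" assume p: "p \<in> half_regular_pairs"
  show "(wkl_extension \<longlongrightarrow> wkl_extension p) (at p within half_regular_pairs)"
  proof (cases "fst (snd p) \<in> pos_def_mats")
    case True
    let ?V = "UNIV \<times> pos_def_mats \<times> UNIV \<times> pos_semidef_mats :: 'n gauss_pair set"
    have V: "q \<in> ?V" if "q \<in> half_regular_pairs" "fst (snd q) \<in> pos_def_mats" for q :: "'n gauss_pair"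
      using that by (cases q) (auto simp: half_regular_pairs_def intro: pos_def_imp_semidef)
    have "(wkl_formula \<longlongrightarrow> wkl_formula p) (at p within ?V)"
      using continuous_on_wkl_formula[unfolded continuous_on_def] V[OF p True] by (rule bspec)
    then have "((\<lambda>q. ereal (wkl_formula q)) \<longlongrightarrow> ereal (wkl_formula p)) (at p within ?V)"
      by (intro tendsto_intros)
    then have "((\<lambda>q. ereal (wkl_formula q)) \<longlongrightarrow> ereal (wkl_formula p)) (at p within half_regular_pairs)"
    proof (rule filterlim_mono_eventually)
      have "\<forall>\<^sub>F q in at p within half_regular_pairs. q \<in> ?V"
        using eventually_first_pos_def[OF True half_regular_subset_all] eventually_in_set
        by eventually_elim (rule V)
      then show "at p within half_regular_pairs \<le> at p within ?V"
        unfolding le_filter_def by (auto simp: eventually_at_filter elim: eventually_elim2)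
    qed auto
    then have "((\<lambda>q. ereal (wkl_formula q)) \<longlongrightarrow> wkl_extension p) (at p within half_regular_pairs)"
      using True by (simp add: wkl_extension_def)
    moreover have "\<forall>\<^sub>F q in at p within half_regular_pairs. ereal (wkl_formula q) = wkl_extension q"
      using eventually_first_pos_def[OF True half_regular_subset_all]
      by eventually_elim (simp add: wkl_extension_def)
    ultimately show ?thesis by (rule Lim_transform_eventually)
  next
    case False
    define S0 where "S0 = fst (snd p)"
    define S1 where "S1 = snd (snd (snd p))"
    have S1: "S1 \<in> pos_def_mats" and S0: "S0 \<in> pos_semidef_mats" "S0 \<notin> pos_def_mats"
      using p False by (auto simp: half_regular_iff all_pairs_def S0_def S1_def)
    obtain v where v: "norm v = 1" "v \<bullet> (S0 *v v) = 0"
      using S0 by (rule semidef_not_def_kernel)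
    obtain c where c: "0 < c" "\<And>T x. dist T S1 < c \<Longrightarrow> c * (x \<bullet> x) \<le> x \<bullet> (T *v x)"
      using S1 by (rule pos_def_locally_bounded_below) blast
    have "\<forall>\<^sub>F q in at p within half_regular_pairs. ereal M < wkl_extension q" for M
    proof -
      \<comment> \<open>Below this threshold for \<open>v \<bullet> S\<^sub>0 v\<close> the lower bound of the blow-up lemma exceeds \<open>M\<close>.\<close>
      define \<delta> where "\<delta> = c / exp (4 * M / c + 1)"
      have "\<delta> > 0" using c(1) by (simp add: \<delta>_def)
      have "((\<lambda>q. v \<bullet> (fst (snd q) *v v)) \<longlongrightarrow> v \<bullet> (S0 *v v)) (at p within half_regular_pairs)"
        unfolding S0_def by (intro tendsto_intros tendsto_covariances)
      then have "\<forall>\<^sub>F q in at p within half_regular_pairs. v \<bullet> (fst (snd q) *v v) < \<delta>"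
        using \<open>\<delta> > 0\<close> v(2) by (intro order_tendstoD(2)) auto
      moreover have "\<forall>\<^sub>F q in at p within half_regular_pairs. dist (snd (snd (snd q))) S1 < c"
        unfolding S1_def by (rule tendstoD[OF tendsto_covariances(2) c(1)])
      moreover have "\<forall>\<^sub>F q in at p within half_regular_pairs. snd (snd (snd q)) \<in> pos_def_mats"
        using S1 by (intro eventually_second_pos_def half_regular_subset_all) (simp add: S1_def)
      ultimately show ?thesis
      proof eventually_elim
        case (elim q)
        obtain n0 T0 n1 T1 where q: "q = (n0, T0, n1, T1)" by (cases q) auto
        show ?case
        proof (cases "T0 \<in> pos_def_mats")
          case True
          have "v \<noteq> 0" using v(1) by auto
          then have v0: "0 < v \<bullet> (T0 *v v)" using True by (simp add: pos_def_mats_def)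
          have "exp (4 * M / c + 1) < c / (v \<bullet> (T0 *v v))"
            using elim(1) v0 c(1) by (simp add: q \<delta>_def field_simps)
          then have "4 * M / c + 1 < ln (c / (v \<bullet> (T0 *v v)))"
            using c(1) v0 by (subst exp_less_cancel_iff[symmetric]) simp
          then have "M < c * (ln (c / (v \<bullet> (T0 *v v))) - 1) / 4"
            using c(1) by (simp add: field_simps)
          also have "\<dots> \<le> wkl_formula q"
            unfolding q using elim c v by (intro wkl_formula_blow_up True) (auto simp: q)
          finally show ?thesis using True by (simp add: wkl_extension_def q)
        qed (simp add: wkl_extension_def q)
      qed
    qed
    then have "(wkl_extension \<longlongrightarrow> \<infinity>) (at p within half_regular_pairs)"
      unfolding tendsto_PInfty by blast
    then show ?thesis using False by (simp add: wkl_extension_def)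
  qed
qed

lemma wkl_extension_ge:
  assumes "(m0, S0, m1, S1) \<in> half_regular_pairs"
  shows "ereal ((norm (m1 - m0))\<^sup>2 / 4) \<le> wkl_extension (m0, S0, m1, S1)"
  using assms wkl_formula_ge[of S0 S1 m1 m0]
  by (auto simp: wkl_extension_def half_regular_pairs_def intro: pos_def_imp_semidef)

lemma is_wkl_extension_wkl_extension:
  "is_wkl_extension (wkl_extension :: 'n::finite gauss_pair \<Rightarrow> ereal)"
  unfolding is_wkl_extension_def
proof (intro conjI ballI continuous_on_wkl_extension)
  show "(wkl_extension :: 'n gauss_pair \<Rightarrow> ereal) ` half_regular_pairs \<subseteq> {0..\<infinity>}"
  proof (intro image_subsetI)
    fix q :: "'n gauss_pair" assume q: "q \<in> half_regular_pairs"
    obtain m0 S0 m1 S1 where qq: "q = (m0, S0, m1, S1)" by (cases q) auto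
    have "0 \<le> ereal ((norm (m1 - m0))\<^sup>2 / 4)" by simp
    also have "\<dots> \<le> wkl_extension q" using q unfolding qq by (rule wkl_extension_ge)
    finally show "wkl_extension q \<in> {0..\<infinity>}" by simp
  qed
  fix p :: "'n gauss_pair" assume "p \<in> regular_pairs"
  then show "wkl_extension p = ereal (wkl_loss p)"
    using wkl_formula_eq_loss[of p] by (auto simp: wkl_extension_def regular_pairs_def)
qed

lemma pos_semidef_add_scaled_identity:
  assumes "S \<in> pos_semidef_mats" "0 < e"
  shows "S + e *\<^sub>R mat 1 \<in> pos_def_mats"
proof -
  have "transpose (S + e *\<^sub>R mat 1) = transpose S + e *\<^sub>R mat 1"
    by (simp add: transpose_def vec_eq_iff mat_def)
  moreover have "x \<bullet> ((S + e *\<^sub>R mat 1) *v x) = x \<bullet> (S *v x) + e * (x \<bullet> x)" for x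
    by (simp add: matrix_vector_mult_add_rdistrib inner_add_right scaleR_matrix_vector_assoc[symmetric])
  ultimately show ?thesis
    using assms by (auto simp: pos_def_mats_def pos_semidef_mats_def intro!: add_nonneg_pos)
qed

text \<open>Adding small multiples of the identity to both covariances shows that the regular pairs are dense.\<close>

lemma is_wkl_extension_unique:
  fixes G H :: "'n::finite gauss_pair \<Rightarrow> ereal"
  assumes G: "is_wkl_extension G" and H: "is_wkl_extension H" and p: "p \<in> half_regular_pairs"
  shows "G p = H p"
proof -
  obtain m0 S0 m1 S1 where pp: "p = (m0, S0, m1, S1)" by (cases p) auto
  have S: "S0 \<in> pos_semidef_mats" "S1 \<in> pos_semidef_mats"
    using p half_regular_subset_all by (auto simp: pp all_pairs_def)
  define s where "s k = (m0, S0 + inverse (real (Suc k)) *\<^sub>R mat 1, m1, S1 + inverse (real (Suc k)) *\<^sub>R mat 1)" for k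
  have s: "s k \<in> regular_pairs" for k
    using S by (auto simp: s_def regular_pairs_def intro!: pos_semidef_add_scaled_identity)
  have "regular_pairs \<subseteq> (half_regular_pairs :: 'n gauss_pair set)"
    by (auto simp: regular_pairs_def half_regular_pairs_def intro: pos_def_imp_semidef)
  with s have sh: "s k \<in> half_regular_pairs" for k by blast
  have "s \<longlonglongrightarrow> (m0, S0 + 0 *\<^sub>R mat 1, m1, S1 + 0 *\<^sub>R mat 1)"
    unfolding s_def by (intro tendsto_intros LIMSEQ_inverse_real_of_nat)
  then have lim: "s \<longlonglongrightarrow> p" by (simp add: pp)
  have "(\<lambda>k. F (s k)) \<longlonglongrightarrow> F p" if "is_wkl_extension F" for F :: "'n gauss_pair \<Rightarrow> ereal"
    using that lim p sh unfolding is_wkl_extension_def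
    by (auto intro: continuous_on_tendsto_compose)
  from this[OF G] this[OF H] show ?thesis
    using G H s unfolding is_wkl_extension_def by (simp add: LIMSEQ_unique)
qed

section \<open>Scalar covariances\<close>

lemma scaled_identity_conj_diag: "e *\<^sub>R mat 1 = conj_diag (mat 1 :: real^'n^'n) (\<chi> i. e)"
  unfolding conj_diag_def transpose_mat matrix_mul_lid matrix_mul_rid
  by (simp add: vec_eq_iff mat_def diag_mat_def)

lemma scaled_identity_pos_def: "0 < e \<Longrightarrow> e *\<^sub>R mat 1 \<in> pos_def_mats"
  and scaled_identity_pos_semidef: "0 \<le> e \<Longrightarrow> e *\<^sub>R mat 1 \<in> pos_semidef_mats"
  unfolding scaled_identity_conj_diag
  by (simp_all add: conj_diag_pos_def_iff conj_diag_pos_semidef_iff orthogonal_matrix_id)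

lemma zero_not_pos_def: "(0 :: real^'n^'n) \<notin> pos_def_mats"
  by (auto simp: pos_def_mats_def intro!: exI[of _ "axis undefined 1"])

text \<open>The transport matrix is \<open>r\<close> times the identity, whatever \<open>e\<close> is, so that \<open>r\<close> can be chosen freely
  while the covariances shrink.\<close>

lemma wkl_formula_scaled_identity:
  fixes m0 m1 :: "real^'n"
  assumes "0 < e" "0 \<le> r"
  shows "wkl_formula (m0, e *\<^sub>R mat 1, m1, (r\<^sup>2 * e) *\<^sub>R mat 1) =
    (psi_profile r * (real CARD('n) * e) + kappa_profile r * (norm (m1 - m0))\<^sup>2) / 4"
proof -
  note I = orthogonal_matrix_id[where 'n='n, where ?'a=real]
  have "conj_diag (mat 1 :: real^'n^'n) (\<chi> i. r) ** (e *\<^sub>R mat 1) ** conj_diag (mat 1) (\<chi> i. r)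
      = (r\<^sup>2 * e) *\<^sub>R mat 1"
    unfolding scaled_identity_conj_diag conj_diag_mult[OF I] by (simp add: power2_eq_square mult_ac)
  then have "transport_mat (e *\<^sub>R mat 1) ((r\<^sup>2 * e) *\<^sub>R mat 1) = conj_diag (mat 1 :: real^'n^'n) (\<chi> i. r)"
    using assms by (intro transport_mat_unique scaled_identity_pos_def)
      (auto simp: conj_diag_pos_semidef_iff[OF I])
  then have "wkl_formula (m0, e *\<^sub>R mat 1, m1, (r\<^sup>2 * e) *\<^sub>R mat 1) =
    (\<Sum>i\<in>UNIV. psi_profile r * (column i (mat 1) \<bullet> ((e *\<^sub>R mat 1) *v column i (mat 1 :: real^'n^'n)))
      + kappa_profile r * (column i (mat 1) \<bullet> (m1 - m0))\<^sup>2) / 4"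
    using assms by (subst wkl_formula_eigen[OF scaled_identity_pos_def scaled_identity_pos_semidef I]) auto
  also have "\<dots> = (\<Sum>i\<in>UNIV. psi_profile r * e + kappa_profile r * (column i (mat 1) \<bullet> (m1 - m0))\<^sup>2) / 4"
    by (simp add: scaleR_matrix_vector_assoc[symmetric] column_unit[OF I])
  also have "(\<Sum>i\<in>UNIV. psi_profile r * e + kappa_profile r * (column i (mat 1) \<bullet> (m1 - m0))\<^sup>2)
      = psi_profile r * (real CARD('n) * e) + kappa_profile r * (norm (m1 - m0))\<^sup>2"
    unfolding power2_norm_eq_inner parseval[OF I, of "m1 - m0" "m1 - m0"]
    by (simp add: sum.distrib sum_distrib_left power2_eq_square)
  finally show ?thesis .
qed

text \<open>Covariances \<open>e I\<close> and \<open>r\<^sup>2 e I\<close> give the limit \<open>\<kappa> r / 4\<close> at two Dirac measures of distance one; it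
  differs for \<open>r = 0\<close> and \<open>r = 1\<close>.\<close>

lemma no_continuous_extension:
  assumes "continuous_on all_pairs (G :: 'n::finite gauss_pair \<Rightarrow> ereal)"
    and G: "\<forall>p\<in>half_regular_pairs. G p = wkl_extension p"
  shows False
proof -
  define m where "m = (axis undefined 1 :: real^'n)"
  define \<epsilon> where "\<epsilon> k = inverse (real (Suc k))" for k
  have \<epsilon>: "0 < \<epsilon> k" "\<epsilon> \<longlonglongrightarrow> 0" for k
    unfolding \<epsilon>_def using LIMSEQ_inverse_real_of_nat by auto
  have lim: "(\<lambda>k. (psi_profile r * (real CARD('n) * \<epsilon> k) + kappa_profile r) / 4) \<longlonglongrightarrow> kappa_profile r / 4"
    and G_lim: "(\<lambda>k. ereal ((psi_profile r * (real CARD('n) * \<epsilon> k) + kappa_profile r) / 4)) \<longlonglongrightarrow> G (0, 0, m, 0)"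
    if "0 \<le> r" for r
  proof -
    have "(\<lambda>k. (psi_profile r * (real CARD('n) * \<epsilon> k) + kappa_profile r) / 4)
        \<longlonglongrightarrow> (psi_profile r * (real CARD('n) * 0) + kappa_profile r) / 4"
      by (intro tendsto_intros \<epsilon>) simp
    then show "(\<lambda>k. (psi_profile r * (real CARD('n) * \<epsilon> k) + kappa_profile r) / 4) \<longlonglongrightarrow> kappa_profile r / 4"
      by simp
    define s where "s k = (0 :: real^'n, \<epsilon> k *\<^sub>R mat 1 :: real^'n^'n, m, (r\<^sup>2 * \<epsilon> k) *\<^sub>R mat 1 :: real^'n^'n)" for k
    have "s \<longlonglongrightarrow> (0, 0 *\<^sub>R mat 1, m, (r\<^sup>2 * 0) *\<^sub>R mat 1)"
      unfolding s_def by (intro tendsto_intros \<epsilon>)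
    then have "s \<longlonglongrightarrow> (0, 0, m, 0)" by simp
    moreover have sh: "s k \<in> half_regular_pairs" for k
      using \<epsilon>(1)[of k] by (auto simp: s_def half_regular_pairs_def
          intro!: scaled_identity_pos_def scaled_identity_pos_semidef)
    moreover have "(0, 0, m, 0) \<in> all_pairs"
      using scaled_identity_pos_semidef[of 0] by (simp add: all_pairs_def)
    moreover have "s k \<in> all_pairs" for k using sh half_regular_subset_all by blast
    ultimately have "(\<lambda>k. G (s k)) \<longlonglongrightarrow> G (0, 0, m, 0)"
      by (intro continuous_on_tendsto_compose[OF assms(1)]) auto
    moreover have "G (s k) = ereal ((psi_profile r * (real CARD('n) * \<epsilon> k) + kappa_profile r) / 4)" for k
      using G sh[of k] wkl_formula_scaled_identity[OF \<epsilon>(1) that, of 0 k m] scaled_identity_pos_def[OF \<epsilon>(1), of k]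
      by (simp add: wkl_extension_def s_def m_def)
    ultimately show "(\<lambda>k. ereal ((psi_profile r * (real CARD('n) * \<epsilon> k) + kappa_profile r) / 4)) \<longlonglongrightarrow> G (0, 0, m, 0)"
      by simp
  qed
  have "G (0, 0, m, 0) = ereal (kappa_profile r / 4)" if "0 \<le> r" for r
    using G_lim[OF that] tendsto_ereal[OF lim[OF that]] by (rule LIMSEQ_unique)
  from this[of 0] this[of 1] show False by (simp add: kappa_profile_def)
qed

section \<open>The extension to two singular covariances\<close>

lemma dirac_extension_half_regular:
  "p \<in> half_regular_pairs \<Longrightarrow> dirac_extension F p = F p"
  by (cases p) (auto simp: dirac_extension_def half_regular_iff)

lemma dirac_extension_ge:
  fixes m0 m1 :: "real^'n"
  assumes "(m0, S0, m1, S1) \<in> all_pairs"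
  shows "ereal ((norm (m1 - m0))\<^sup>2 / 4) \<le> dirac_extension wkl_extension (m0, S0, m1, S1)"
proof (cases "(m0, S0, m1, S1) \<in> half_regular_pairs")
  case True
  then show ?thesis by (simp add: dirac_extension_half_regular wkl_extension_ge)
next
  case False
  then show ?thesis using assms by (auto simp: dirac_extension_def half_regular_iff)
qed

text \<open>At two singular covariances the value is the lower bound that holds at all pairs, and this bound is
  continuous.\<close>

lemma lower_semicontinuous_dirac_extension:
  "lower_semicontinuous_on all_pairs (dirac_extension (wkl_extension :: 'n::finite gauss_pair \<Rightarrow> ereal))"
  unfolding lower_semicontinuous_on_def
proof (intro ballI allI impI)
  fix p :: "'n gauss_pair" and a
  assume p: "p \<in> all_pairs" and a: "a < dirac_extension wkl_extension p"
  show "\<forall>\<^sub>F q in at p within all_pairs. a < dirac_extension wkl_extension q"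
  proof (cases "p \<in> half_regular_pairs")
    case True
    have half: "\<forall>\<^sub>F q in at p within all_pairs. q \<in> half_regular_pairs"
    proof (cases "fst (snd p) \<in> pos_def_mats")
      case True
      from eventually_first_pos_def[OF this order_refl] eventually_in_set show ?thesis
        by eventually_elim (simp add: half_regular_iff)
    next
      case False
      with \<open>p \<in> half_regular_pairs\<close> have "snd (snd (snd p)) \<in> pos_def_mats"
        by (simp add: half_regular_iff)
      from eventually_second_pos_def[OF this order_refl] eventually_in_set show ?thesis
        by eventually_elim (simp add: half_regular_iff)
    qed
    have "(wkl_extension \<longlongrightarrow> wkl_extension p) (at p within half_regular_pairs)"
      using continuous_on_wkl_extension[unfolded continuous_on_def] True by (rule bspec)
    moreover have "a < wkl_extension p" using a True by (simp add: dirac_extension_half_regular)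
    ultimately have "\<forall>\<^sub>F q in at p within half_regular_pairs. a < wkl_extension q"
      by (rule order_tendstoD(1))
    then have "\<forall>\<^sub>F q in at p within all_pairs. q \<in> half_regular_pairs \<longrightarrow> a < wkl_extension q"
      unfolding eventually_at_filter by (rule eventually_mono) auto
    with half show ?thesis
      by eventually_elim (simp add: dirac_extension_half_regular)
  next
    case False
    obtain m0 S0 m1 S1 where pp: "p = (m0, S0, m1, S1)" by (cases p) auto
    have "((\<lambda>q::'n gauss_pair. ereal ((norm (fst (snd (snd q)) - fst q))\<^sup>2 / 4))
        \<longlongrightarrow> ereal ((norm (fst (snd (snd p)) - fst p))\<^sup>2 / 4)) (at p within all_pairs)"
      by (intro tendsto_intros tendsto_fst tendsto_snd) simp_all
    moreover have "a < ereal ((norm (fst (snd (snd p)) - fst p))\<^sup>2 / 4)"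
      using a p False by (auto simp: pp dirac_extension_def half_regular_iff)
    ultimately have "\<forall>\<^sub>F q in at p within all_pairs. a < ereal ((norm (fst (snd (snd q)) - fst q))\<^sup>2 / 4)"
      by (rule order_tendstoD(1))
    with eventually_in_set show ?thesis
    proof eventually_elim
      case (elim q)
      then show ?case
        using dirac_extension_ge[of "fst q" "fst (snd q)" "fst (snd (snd q))" "snd (snd (snd q))"] by simp
    qed
  qed
qed

text \<open>The lower bound by the means holds everywhere. It is attained in the limit when the transport matrix
  tends to zero together with the covariances, because \<open>kappa_profile 0 = 1\<close>.\<close>

lemma liminf_wkl_loss_at_dirac:
  fixes m0 m1 :: "real^'n"
  shows "Liminf (at (0, 0) within pos_def_mats \<times> pos_def_mats)
      (\<lambda>(S0, S1). ereal (wkl_loss (m0, S0, m1, S1))) = ereal ((norm (m1 - m0))\<^sup>2 / 4)"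
    (is "Liminf ?F ?f = ereal ?C")
proof (rule antisym)
  have f: "?f (S0, S1) = ereal (wkl_formula (m0, S0, m1, S1))"
    if "S0 \<in> pos_def_mats" "S1 \<in> pos_def_mats" for S0 S1
    using wkl_formula_eq_loss[of "(m0, S0, m1, S1)"] that by (simp add: regular_pairs_def)
  show "ereal ?C \<le> Liminf ?F ?f"
  proof (rule Liminf_bounded)
    show "\<forall>\<^sub>F x in ?F. ereal ?C \<le> ?f x"
      using eventually_in_set
    proof eventually_elim
      case (elim x)
      then obtain S0 S1 where "x = (S0, S1)" "S0 \<in> pos_def_mats" "S1 \<in> pos_def_mats" by auto
      then show ?case using f wkl_formula_ge[OF _ pos_def_imp_semidef, of S0 S1 m1 m0] by simp
    qed
  qed
  show "Liminf ?F ?f \<le> ereal ?C"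
  proof (rule ccontr)
    assume "\<not> ?thesis"
    then obtain y where y: "ereal ?C < y" "y < Liminf ?F ?f" using dense by (metis not_le)
    define \<epsilon> where "\<epsilon> k = inverse (real (Suc k))" for k
    have \<epsilon>: "0 < \<epsilon> k" "\<epsilon> \<longlonglongrightarrow> 0" for k
      unfolding \<epsilon>_def using LIMSEQ_inverse_real_of_nat by auto
    \<comment> \<open>Both covariances vanish, the second one faster, so that the transport matrix
      \<open>\<epsilon> k *\<^sub>R mat 1\<close> vanishes as well.\<close>
    define s where "s k = (\<epsilon> k *\<^sub>R mat 1 :: real^'n^'n, ((\<epsilon> k)\<^sup>2 * \<epsilon> k) *\<^sub>R mat 1 :: real^'n^'n)" for k
    have spd: "fst (s k) \<in> pos_def_mats" "snd (s k) \<in> pos_def_mats" for k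
      using \<epsilon>(1)[of k] by (auto simp: s_def intro!: scaled_identity_pos_def)
    have "s \<longlonglongrightarrow> (0 *\<^sub>R mat 1, (0\<^sup>2 * 0) *\<^sub>R mat 1)"
      unfolding s_def by (intro tendsto_intros \<epsilon>)
    then have "s \<longlonglongrightarrow> (0, 0)" by simp
    moreover have "s k \<noteq> (0, 0)" for k
      using spd(1)[of k] zero_not_pos_def by (metis fst_conv)
    ultimately have "filterlim s ?F sequentially"
      using spd by (auto simp: filterlim_at mem_Times_iff)
    then have "\<forall>\<^sub>F k in sequentially. y < ?f (s k)"
      using less_LiminfD[OF y(2)] by (auto simp: filterlim_iff)
    moreover have fs: "?f (s k) = ereal ((psi_profile (\<epsilon> k) * (real CARD('n) * \<epsilon> k) + kappa_profile (\<epsilon> k) * (norm (m1 - m0))\<^sup>2) / 4)" for k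
      using f[OF spd[of k]] wkl_formula_scaled_identity[OF \<epsilon>(1) less_imp_le[OF \<epsilon>(1)], of m0 k m1 k]
      by (simp add: s_def)
    have "(\<lambda>k. ?f (s k)) \<longlonglongrightarrow> ereal ((psi_profile 0 * (real CARD('n) * 0) + kappa_profile 0 * (norm (m1 - m0))\<^sup>2) / 4)"
    proof -
      have psi: "continuous_on {0..} psi_profile"
        unfolding psi_profile_def by (intro continuous_intros continuous_on_chi_profile)
      have ev: "\<forall>\<^sub>F k in sequentially. \<epsilon> k \<in> {0..}" using \<epsilon>(1) by (simp add: less_imp_le)
      show ?thesis
        unfolding fs
        by (intro tendsto_intros \<epsilon>(2) continuous_on_tendsto_compose[OF psi \<epsilon>(2) _ ev]
            continuous_on_tendsto_compose[OF continuous_on_kappa_profile \<epsilon>(2) _ ev]) simp_all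
    qed
    then have "(\<lambda>k. ?f (s k)) \<longlonglongrightarrow> ereal ?C" by (simp add: kappa_profile_def)
    then have "\<forall>\<^sub>F k in sequentially. ?f (s k) < y" using y(1) by (rule order_tendstoD(2))
    ultimately have "\<forall>\<^sub>F k in sequentially. False" by eventually_elim simp
    then show False by simp
  qed
qed

lemma pos_def_invertible:
  assumes "S \<in> pos_def_mats"
  shows "invertible S"
proof -
  obtain P d where P: "orthogonal_matrix P" and S: "S = conj_diag P d" and d: "\<And>i. 0 < d $ i"
    using assms by (rule spectral_theorem_pos_def) blast
  have "det S = (\<Prod>i\<in>UNIV. d $ i)" unfolding S by (rule det_conj_diag[OF P])
  also have "\<dots> > 0" using d by (intro prod_pos) simp
  finally show ?thesis by (simp add: invertible_det_nz)
qed

theorem theorem9: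
  shows "continuous_on regular_pairs (wkl_loss :: 'n::finite gauss_pair \<Rightarrow> real) \<and>
    (\<exists>Lbar :: 'n gauss_pair \<Rightarrow> ereal.
       is_wkl_extension Lbar \<and>
       (\<forall>G. is_wkl_extension G \<longrightarrow> (\<forall>p\<in>half_regular_pairs. G p = Lbar p)) \<and>
       (\<forall>m0 S0 m1 S1. S0 \<in> pos_def_mats \<and> S1 \<in> pos_semidef_mats \<longrightarrow>
          (let R = transport_mat S0 S1 in
           Lbar (m0, S0, m1, S1) = ereal
             (trace (S0 - S1 + S0 ** spectral_fun chi_profile R) / 4
              + ((m1 - m0) \<bullet> (spectral_fun kappa_profile R *v (m1 - m0))) / 4))) \<and>
       (\<forall>m0 S0 m1 S1. S0 \<in> pos_semidef_mats \<and> \<not> invertible S0 \<and> S1 \<in> pos_def_mats \<longrightarrow>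
          Lbar (m0, S0, m1, S1) = \<infinity>) \<and>
       \<not> (\<exists>G :: 'n gauss_pair \<Rightarrow> ereal. continuous_on all_pairs G \<and>
            (\<forall>p\<in>half_regular_pairs. G p = Lbar p)) \<and>
       (\<forall>p\<in>half_regular_pairs. dirac_extension Lbar p = Lbar p) \<and>
       dirac_extension Lbar ` all_pairs \<subseteq> {0..\<infinity>} \<and>
       lower_semicontinuous_on all_pairs (dirac_extension Lbar) \<and>
       (\<forall>m0 m1 :: real^'n. Liminf (at (0, 0) within pos_def_mats \<times> pos_def_mats)
            (\<lambda>(S0, S1). ereal (wkl_loss (m0, S0, m1, S1)))
          = ereal ((norm (m1 - m0))\<^sup>2 / 4)) \<and>
       (\<forall>m0 m1 :: real^'n. dirac_extension Lbar (m0, 0, m1, 0)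
          = Liminf (at (0, 0) within pos_def_mats \<times> pos_def_mats)
              (\<lambda>(S0, S1). ereal (wkl_loss (m0, S0, m1, S1)))))"
proof (intro conjI exI[of _ wkl_extension] allI impI ballI)
  show "continuous_on regular_pairs (wkl_loss :: 'n gauss_pair \<Rightarrow> real)"
  proof (rule continuous_on_eq)
    show "continuous_on regular_pairs (wkl_formula :: 'n gauss_pair \<Rightarrow> real)"
      by (rule continuous_on_subset[OF continuous_on_wkl_formula])
        (auto simp: regular_pairs_def intro: pos_def_imp_semidef)
  qed (rule wkl_formula_eq_loss)
  show "is_wkl_extension (wkl_extension :: 'n gauss_pair \<Rightarrow> ereal)"
    by (rule is_wkl_extension_wkl_extension)
  show "G p = wkl_extension p" if "is_wkl_extension G" "p \<in> half_regular_pairs"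
    for G :: "'n gauss_pair \<Rightarrow> ereal" and p
    by (rule is_wkl_extension_unique[OF that(1) is_wkl_extension_wkl_extension that(2)])
  show "let R = transport_mat S0 S1 in wkl_extension (m0, S0, m1, S1) = ereal
      (trace (S0 - S1 + S0 ** spectral_fun chi_profile R) / 4
        + ((m1 - m0) \<bullet> (spectral_fun kappa_profile R *v (m1 - m0))) / 4)"
    if "S0 \<in> pos_def_mats \<and> S1 \<in> pos_semidef_mats" for m0 m1 :: "real^'n" and S0 S1
    using that by (simp add: wkl_extension_def wkl_formula_def Let_def)
  show "wkl_extension (m0, S0, m1, S1) = \<infinity>"
    if "S0 \<in> pos_semidef_mats \<and> \<not> invertible S0 \<and> S1 \<in> pos_def_mats" for m0 m1 :: "real^'n" and S0 S1
    using that pos_def_invertible by (auto simp: wkl_extension_def)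
  show "\<not> (\<exists>G :: 'n gauss_pair \<Rightarrow> ereal. continuous_on all_pairs G \<and>
      (\<forall>p\<in>half_regular_pairs. G p = wkl_extension p))"
    using no_continuous_extension by blast
  show "dirac_extension wkl_extension p = wkl_extension p" if "p \<in> half_regular_pairs" for p :: "'n gauss_pair"
    by (rule dirac_extension_half_regular[OF that])
  show "dirac_extension (wkl_extension :: 'n gauss_pair \<Rightarrow> ereal) ` all_pairs \<subseteq> {0..\<infinity>}"
  proof (intro image_subsetI)
    fix q :: "'n gauss_pair" assume q: "q \<in> all_pairs"
    obtain m0 S0 m1 S1 where qq: "q = (m0, S0, m1, S1)" by (cases q) auto
    have "0 \<le> ereal ((norm (m1 - m0))\<^sup>2 / 4)" by simp
    also have "\<dots> \<le> dirac_extension wkl_extension q" using q unfolding qq by (rule dirac_extension_ge)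
    finally show "dirac_extension wkl_extension q \<in> {0..\<infinity>}" by simp
  qed
  show "lower_semicontinuous_on all_pairs (dirac_extension (wkl_extension :: 'n gauss_pair \<Rightarrow> ereal))"
    by (rule lower_semicontinuous_dirac_extension)
  fix m0 m1 :: "real^'n"
  show "Liminf (at (0, 0) within pos_def_mats \<times> pos_def_mats)
      (\<lambda>(S0, S1). ereal (wkl_loss (m0, S0, m1, S1))) = ereal ((norm (m1 - m0))\<^sup>2 / 4)"
    by (rule liminf_wkl_loss_at_dirac)
  show "dirac_extension wkl_extension (m0, 0, m1, 0)
      = Liminf (at (0, 0) within pos_def_mats \<times> pos_def_mats)
          (\<lambda>(S0, S1). ereal (wkl_loss (m0, S0, m1, S1)))"
    unfolding liminf_wkl_loss_at_dirac by (simp add: dirac_extension_def zero_not_pos_def)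
qed

end
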